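(* Let $C \subset \mathbb{P}^{2}$ be an irreducible and reduced curve in the complex projective plane of degree $d = \deg C \geq 3$ with singular locus $\mathrm{Sing}(C) = \{p_{1}, \ldots, p_{s}\}$ consisting of $s \geq 3$ distinct points, and let $m_{i} = \mathrm{mult}_{p_{i}}(C) \geq 2$ denote the multiplicity of $C$ at $p_{i}$, with the points labelled so that $m_{1} \geq \cdots \geq m_{s}$. Then $$C^{2} = d^{2} \geq \sum_{i=1}^{s} m_{i}(m_{i}-1) + \mathrm{gon}(C).$$
   Context: We work over the complex numbers. The gonality $\mathrm{gon}(C)$ of a complex curve $C$ is the smallest degree of a non-constant map, defined over the complex numbers, from $C$ to the complex projective line $\mathbb{P}^{1}$. $C^2$ denotes the self-intersection number of $C$ in $\mathbb{P}^2$, which equals $d^2$. *)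

theory Defs
  imports "HOL-Analysis.Analysis" "HOL-Computational_Algebra.Computational_Algebra"
begin

section \<open>Complex projective spaces\<close>

definition proj_eq :: "complex ^ 'n \<Rightarrow> complex ^ 'n \<Rightarrow> bool" where
  "proj_eq u v \<longleftrightarrow> u \<noteq> 0 \<and> v \<noteq> 0 \<and> (\<exists>c. v = c *s u)"

quotient_type 'n cproj = "complex ^ 'n::finite" / partial: proj_eq
proof (rule part_equivpI)
  show "\<exists>x :: complex ^ 'n. proj_eq x x"
  proof
    show "proj_eq (1 :: complex ^ 'n) 1"
      unfolding proj_eq_def by (auto intro!: exI[of _ 1])
  qed
  show "symp (proj_eq :: complex ^ 'n \<Rightarrow> complex ^ 'n \<Rightarrow> bool)"
  proof (rule sympI)
    fix x y :: "complex ^ 'n"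
    assume "proj_eq x y"
    then obtain c where *: "x \<noteq> 0" "y \<noteq> 0" "y = c *s x"
      unfolding proj_eq_def by blast
    then have "x = inverse c *s y"
      by (cases "c = 0") (auto simp: vec_eq_iff)
    with * show "proj_eq y x"
      unfolding proj_eq_def by blast
  qed
  show "transp (proj_eq :: complex ^ 'n \<Rightarrow> complex ^ 'n \<Rightarrow> bool)"
    by (rule transpI) (auto simp: proj_eq_def vector_smult_assoc)
qed

text \<open>The points of \<^typ>\<open>'n cproj\<close> are the classes of nonzero vectors, so the projective line
  is \<^typ>\<open>2 cproj\<close> and the projective plane is \<^typ>\<open>3 cproj\<close>.\<close>

definition hom_coords :: "complex ^ 'n::finite \<Rightarrow> 'n cproj \<Rightarrow> bool" where
  "hom_coords v p \<longleftrightarrow> v \<noteq> 0 \<and> abs_cproj v = p"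

section \<open>Ternary forms\<close>

text \<open>The ring of polynomials in three variables is \<^typ>\<open>complex poly poly poly\<close>: the innermost
  variable is the first coordinate and the outermost variable is the third one.\<close>

type_synonym poly3 = "complex poly poly poly"

definition coeff3 :: "poly3 \<Rightarrow> nat \<Rightarrow> nat \<Rightarrow> nat \<Rightarrow> complex" where
  "coeff3 F i j k = coeff (coeff (coeff F k) j) i"

definition eval3 :: "poly3 \<Rightarrow> complex ^ 3 \<Rightarrow> complex" where
  "eval3 F v = poly (poly (poly F [:[:v $ 3:]:]) [:v $ 2:]) (v $ 1)"

definition partial3 :: "nat \<Rightarrow> nat \<Rightarrow> nat \<Rightarrow> poly3 \<Rightarrow> poly3" where
  "partial3 i j k F =
     ((map_poly (map_poly pderiv)) ^^ i) (((map_poly pderiv) ^^ j) ((pderiv ^^ k) F))"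

definition homogeneous3 :: "nat \<Rightarrow> poly3 \<Rightarrow> bool" where
  "homogeneous3 d F \<longleftrightarrow> (\<forall>i j k. coeff3 F i j k \<noteq> 0 \<longrightarrow> i + j + k = d)"

definition vanishes_at :: "poly3 \<Rightarrow> 3 cproj \<Rightarrow> bool" where
  "vanishes_at F p \<longleftrightarrow> (\<forall>v. hom_coords v p \<longrightarrow> eval3 F v = 0)"

section \<open>Plane curves\<close>

definition plane_curve :: "poly3 \<Rightarrow> 3 cproj set" where
  "plane_curve F = {p. vanishes_at F p}"

definition singular_locus :: "poly3 \<Rightarrow> 3 cproj set" where
  "singular_locus F = {p \<in> plane_curve F. vanishes_at (partial3 1 0 0 F) p \<and>
     vanishes_at (partial3 0 1 0 F) p \<and> vanishes_at (partial3 0 0 1 F) p}"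

text \<open>Order of vanishing at \<^term>\<open>p\<close>. By Euler's relation it makes no difference whether one
  differentiates the form in its three homogeneous variables or its dehomogenization
  in two affine ones.\<close>

definition curve_mult :: "poly3 \<Rightarrow> 3 cproj \<Rightarrow> nat" where
  "curve_mult F p = (LEAST m. \<exists>i j k. i + j + k = m \<and> \<not> vanishes_at (partial3 i j k F) p)"

section \<open>Gonality\<close>

text \<open>A map from a plane curve to the projective line is given by two forms \<^term>\<open>A\<close>, \<^term>\<open>B\<close> of the
  same degree as the rational map \<open>p \<mapsto> (A(p) : B(p))\<close>. Such a map may be undefined at finitely
  many points; equivalently, it is a morphism on the normalization.\<close>

definition maps_to :: "poly3 \<Rightarrow> poly3 \<Rightarrow> 3 cproj \<Rightarrow> 2 cproj \<Rightarrow> bool" where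
  "maps_to A B p q \<longleftrightarrow>
     (\<exists>v. hom_coords v p \<and> hom_coords (vector [eval3 A v, eval3 B v]) q)"

definition map_fibre :: "3 cproj set \<Rightarrow> poly3 \<Rightarrow> poly3 \<Rightarrow> 2 cproj \<Rightarrow> 3 cproj set" where
  "map_fibre C A B q = {p \<in> C. maps_to A B p q}"

definition nonconstant_map :: "3 cproj set \<Rightarrow> poly3 \<Rightarrow> poly3 \<Rightarrow> bool" where
  "nonconstant_map C A B \<longleftrightarrow> (\<exists>e. homogeneous3 e A \<and> homogeneous3 e B) \<and>
     (\<exists>q q'. q \<noteq> q' \<and> map_fibre C A B q \<noteq> {} \<and> map_fibre C A B q' \<noteq> {})"

text \<open>The degree is the number of points in a general fibre. The finitely many points where the
  pair of forms is undefined, and the singular points, only affect finitely many fibres.\<close>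

definition map_degree :: "3 cproj set \<Rightarrow> poly3 \<Rightarrow> poly3 \<Rightarrow> nat" where
  "map_degree C A B = (THE n. finite {q. card (map_fibre C A B q) \<noteq> n})"

definition gonality :: "3 cproj set \<Rightarrow> nat" where
  "gonality C = (LEAST n. \<exists>A B. nonconstant_map C A B \<and> map_degree C A B = n)"

end

theory Submission
  imports Defs "Subresultants.Subresultant_Gcd" "HOL-Computational_Algebra.Field_as_Ring"
begin

text \<open>The inequality is the sum of the two bounds \<open>\<Sum> m\<^sub>i (m\<^sub>i - 1) \<le> d (d - 1)\<close> and
  \<open>gon C \<le> d\<close>, and both are read off from the projection of \<open>C\<close> from a general point \<open>P\<close> of
  the plane.

  Choose coordinates with \<open>P = (0 : 0 : 1)\<close>. Since \<open>P\<close> is not on the curve, \<open>F\<close> has degree \<open>d\<close> in the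
  third variable \<open>z\<close>, with a constant leading coefficient. On a chart \<open>x = c\<close> the lines through \<open>P\<close> are
  parametrized by \<open>t = y\<close>, and \<open>F\<close> becomes a polynomial \<open>f\<close> in \<open>t\<close> and \<open>z\<close>. Let \<open>D(t)\<close> be the
  resultant of \<open>f\<close> and its \<open>z\<close>-derivative. It is not zero, because an irreducible \<open>F\<close> has no factor in
  common with its derivative (\<open>ex_curve_chart\<close>), and its degree is at most \<open>d (d - 1)\<close>
  (\<open>degree_disc\<close>).

  If \<open>D(t) \<noteq> 0\<close>, the line over \<open>t\<close> meets the curve in \<open>d\<close> distinct points. So all but finitely many
  fibres of the projection have \<open>d\<close> elements, and the gonality is at most \<open>d\<close>
  (\<open>gonality_le_degree\<close>). If a point of multiplicity \<open>m\<close> lies over \<open>t\<close>, then \<open>D\<close> vanishes at \<open>t\<close> to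
  order at least \<open>m (m - 1)\<close> (\<open>order_disc\<close>), the local case of the Bezout bound for the curve and its
  polar with respect to \<open>P\<close>. For a general \<open>P\<close> the singular points lie on different lines through \<open>P\<close>
  (\<open>ex_generic_centre\<close>), so these orders add up to at most the degree of \<open>D\<close>.

  The order bound is a weight count in the Sylvester matrix (\<open>power_dvd_resultant\<close>). It applies to a
  point at the origin, to which every point can be moved because a translation of \<open>z\<close> does not change
  the resultant (\<open>resultant_pcompose_shift\<close>).\<close>

section \<open>Ternary forms as functions\<close>


definition ev3 :: "poly3 \<Rightarrow> complex \<Rightarrow> complex \<Rightarrow> complex \<Rightarrow> complex" where
  "ev3 F x y z = poly (poly (poly F [:[:z:]:]) [:y:]) x"

lemma eval3_vector: "eval3 F (vector [x, y, z]) = ev3 F x y z"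
  by (simp add: eval3_def ev3_def)

lemma ev3_mult [simp]: "ev3 (F * G) x y z = ev3 F x y z * ev3 G x y z"
  and ev3_power [simp]: "ev3 (F ^ n) x y z = ev3 F x y z ^ n"
  and ev3_smult [simp]: "ev3 (Polynomial.smult [:[:c:]:] F) x y z = c * ev3 F x y z"
  and ev3_0 [simp]: "ev3 0 x y z = 0"
  and ev3_1 [simp]: "ev3 1 x y z = 1"
  by (simp_all add: ev3_def)

lemma ev3_sum: "ev3 (sum f A) x y z = (\<Sum>i\<in>A. ev3 (f i) x y z)"
  by (simp add: ev3_def poly_sum)

lemma ev3_prod: "ev3 (prod f A) x y z = (\<Prod>i\<in>A. ev3 (f i) x y z)"
  by (simp add: ev3_def poly_prod)

text \<open>A form is determined by its values since the complex numbers are infinite. Identities between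
  substituted forms can therefore be checked on points.\<close>

lemma ev3_ext:
  assumes "\<And>x y z. ev3 F x y z = ev3 G x y z"
  shows "F = G"
proof -
  have "F - G = 0"
  proof (rule ccontr)
    assume "F - G \<noteq> 0"
    then have "finite {r. poly (F - G) r = 0}"
      by (rule poly_roots_finite)
    moreover have "infinite (range (\<lambda>z::complex. [:[:z:]:]))"
      using infinite_UNIV_char_0 by (subst finite_image_iff) (auto simp: inj_def)
    ultimately obtain z where z: "poly (F - G) [:[:z:]:] \<noteq> 0"
      by (metis (mono_tags, lifting) finite_subset image_subsetI mem_Collect_eq)
    then have "finite {r. poly (poly (F - G) [:[:z:]:]) r = 0}"
      by (rule poly_roots_finite)
    moreover have "infinite (range (\<lambda>y::complex. [:y:]))"
      using infinite_UNIV_char_0 by (subst finite_image_iff) (auto simp: inj_def)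
    ultimately obtain y where y: "poly (poly (F - G) [:[:z:]:]) [:y:] \<noteq> 0"
      by (metis (mono_tags, lifting) finite_subset image_subsetI mem_Collect_eq)
    then obtain x where "poly (poly (poly (F - G) [:[:z:]:]) [:y:]) x \<noteq> 0"
      using poly_all_0_iff_0 by blast
    then show False
      using assms[of x y z] by (simp add: ev3_def)
  qed
  then show ?thesis by simp
qed

lemma ev3_expand:
  "ev3 F x y z = (\<Sum>k\<le>degree F. \<Sum>j\<le>degree (coeff F k). \<Sum>i\<le>degree (coeff (coeff F k) j).
     coeff3 F i j k * (x ^ i * y ^ j * z ^ k))"
proof -
  have "ev3 F x y z = (\<Sum>k\<le>degree F. poly (poly (coeff F k) [:y:]) x * z ^ k)"
    unfolding ev3_def poly_altdef[of F] by (simp add: poly_sum poly_const_pow mult.commute)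
  also have "\<dots> = (\<Sum>k\<le>degree F. (\<Sum>j\<le>degree (coeff F k). poly (coeff (coeff F k) j) x * y ^ j) * z ^ k)"
    unfolding poly_altdef[of "coeff F _"] by (simp add: poly_sum poly_const_pow mult.commute)
  also have "\<dots> = (\<Sum>k\<le>degree F. \<Sum>j\<le>degree (coeff F k). \<Sum>i\<le>degree (coeff (coeff F k) j).
     coeff3 F i j k * (x ^ i * y ^ j * z ^ k))"
    unfolding poly_altdef[of "coeff (coeff F _) _"] coeff3_def
    by (simp add: sum_distrib_left sum_distrib_right mult_ac)
  finally show ?thesis .
qed

lemma ev3_homogeneous:
  assumes "homogeneous3 d F"
  shows "ev3 F (s * x) (s * y) (s * z) = s ^ d * ev3 F x y z"
  unfolding ev3_expand sum_distrib_left
proof (intro sum.cong refl)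
  fix i j k
  show "coeff3 F i j k * ((s * x) ^ i * (s * y) ^ j * (s * z) ^ k) =
      s ^ d * (coeff3 F i j k * (x ^ i * y ^ j * z ^ k))"
  proof (cases "coeff3 F i j k = 0")
    case False
    with assms have "d = i + j + k"
      by (auto simp: homogeneous3_def)
    then show ?thesis
      by (simp add: power_mult_distrib power_add mult_ac)
  qed simp
qed

lemma ex_subst3:
  "\<exists>G. \<forall>x y z. ev3 G x y z = ev3 F (ev3 A x y z) (ev3 B x y z) (ev3 C x y z)"
  by (rule exI[of _ "\<Sum>k\<le>degree F. \<Sum>j\<le>degree (coeff F k). \<Sum>i\<le>degree (coeff (coeff F k) j).
     [:[:[:coeff3 F i j k:]:]:] * (A ^ i * B ^ j * C ^ k)"])
     (simp add: ev3_sum ev3_expand[of F])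

text \<open>Specified by its values, which determine it by \<open>ev3_ext\<close>, so that the laws of substitution need
  no recursion over the three layers of coefficients.\<close>

definition subst3 :: "poly3 \<Rightarrow> poly3 \<Rightarrow> poly3 \<Rightarrow> poly3 \<Rightarrow> poly3" where
  "subst3 A B C F = (SOME G. \<forall>x y z. ev3 G x y z = ev3 F (ev3 A x y z) (ev3 B x y z) (ev3 C x y z))"

lemma ev3_subst3 [simp]:
  "ev3 (subst3 A B C F) x y z = ev3 F (ev3 A x y z) (ev3 B x y z) (ev3 C x y z)"
  using someI_ex[OF ex_subst3[of F A B C]] unfolding subst3_def by blast

text \<open>An invertible substitution is a ring automorphism, so it preserves factorizations and units.\<close>

lemma irreducible_subst3:
  assumes F: "irreducible F"
    and inv: "\<And>H. subst3 A' B' C' (subst3 A B C H) = H" "\<And>H. subst3 A B C (subst3 A' B' C' H) = H"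
  shows "irreducible (subst3 A B C F)"
proof -
  have mult: "subst3 A B C (G * H) = subst3 A B C G * subst3 A B C H" for A B C G H
    by (rule ev3_ext) simp
  have one: "subst3 A B C 1 = 1" and zero: "subst3 A B C 0 = 0" for A B C
    by (rule ev3_ext; simp)+
  have unit: "subst3 A B C G dvd 1" if "G dvd 1" for A B C G
    using that unfolding dvd_def by (metis mult one)
  show ?thesis
  proof (rule irreducibleI)
    show "subst3 A B C F \<noteq> 0"
      using F inv(1) zero by (metis irreducible_def)
    show "\<not> subst3 A B C F dvd 1"
      using F inv(1) unit by (metis irreducible_def)
    fix G H assume "subst3 A B C F = G * H"
    then have "F = subst3 A' B' C' G * subst3 A' B' C' H"
      using inv(1) mult by metis
    with F have "subst3 A' B' C' G dvd 1 \<or> subst3 A' B' C' H dvd 1"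
      by (simp add: irreducible_def)
    then show "G dvd 1 \<or> H dvd 1"
      using unit inv(2) by metis
  qed
qed

definition linform :: "complex \<Rightarrow> complex \<Rightarrow> complex \<Rightarrow> poly3" where
  "linform a b c = [:[:[:0, a:], [:b:]:], [:[:c:]:]:]"

lemma ev3_linform [simp]: "ev3 (linform a b c) x y z = a * x + b * y + c * z"
  by (simp add: linform_def ev3_def mult.commute)

lemma homogeneous3_linform: "homogeneous3 1 (linform a b c)"
  by (auto simp: homogeneous3_def coeff3_def linform_def coeff_pCons split: nat.splits)

lemma linform_eq_0_iff: "linform a b c = 0 \<longleftrightarrow> a = 0 \<and> b = 0 \<and> c = 0"
  by (simp add: linform_def)

section \<open>Restriction of a form to a line\<close>

text \<open>The form along a parametrized curve \<open>s \<mapsto> (a(s), b(s), c(s))\<close>. The recursive shape makes the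
  chain rule \<open>pderiv_restrict3\<close> an induction; degrees are read off from \<open>restrict3_expand\<close> instead.\<close>

definition restrict3 :: "poly3 \<Rightarrow> complex poly \<Rightarrow> complex poly \<Rightarrow> complex poly \<Rightarrow> complex poly" where
  "restrict3 F a b c = poly (map_poly (\<lambda>q. poly (map_poly (\<lambda>r. pcompose r a) q) b) F) c"

lemma poly_restrict3: "poly (restrict3 F a b c) s = ev3 F (poly a s) (poly b s) (poly c s)"
proof -
  have 1: "poly (poly (map_poly (\<lambda>r. pcompose r a) q) b) s = poly (poly q [:poly b s:]) (poly a s)" for q
    by (induction q) (simp_all add: Polynomial.map_poly_pCons poly_pcompose)
  show ?thesis
    unfolding restrict3_def ev3_def
    by (induction F) (simp_all add: Polynomial.map_poly_pCons 1)
qed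

lemma restrict3_expand:
  "restrict3 F a b c = (\<Sum>k\<le>degree F. \<Sum>j\<le>degree (coeff F k). \<Sum>i\<le>degree (coeff (coeff F k) j).
     Polynomial.smult (coeff3 F i j k) (a ^ i * b ^ j * c ^ k))"
  by (rule poly_ext) (simp add: poly_restrict3 ev3_expand poly_sum)

lemma coeff_mult_le:
  fixes p q :: "'a::comm_ring_1 poly"
  assumes "degree p \<le> m" "degree q \<le> n"
  shows "coeff (p * q) (m + n) = coeff p m * coeff q n"
proof -
  have "coeff (p * q) (m + n) = (\<Sum>i\<le>m + n. if i = m then coeff p m * coeff q n else 0)"
    unfolding coeff_mult
  proof (intro sum.cong refl)
    fix i assume "i \<in> {..m + n}"
    then show "coeff p i * coeff q (m + n - i) = (if i = m then coeff p m * coeff q n else 0)"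
      using assms by (cases i m rule: linorder_cases) (auto simp: coeff_eq_0)
  qed
  then show ?thesis by simp
qed

lemma degree_coeff_linear_power:
  fixes a :: "'a::comm_ring_1 poly"
  assumes "degree a \<le> 1"
  shows "degree (a ^ n) \<le> n \<and> coeff (a ^ n) n = coeff a 1 ^ n"
proof (induction n)
  case (Suc n)
  then have "degree (a ^ Suc n) \<le> Suc n"
    using assms degree_mult_le[of a "a ^ n"] by simp
  moreover have "coeff (a * a ^ n) (1 + n) = coeff a 1 * coeff (a ^ n) n"
    using Suc assms by (intro coeff_mult_le) auto
  ultimately show ?case using Suc by simp
qed simp

lemma degree_coeff_linear_monomial:
  fixes a b c :: "'a::comm_ring_1 poly"
  assumes "degree a \<le> 1" "degree b \<le> 1" "degree c \<le> 1"
  shows "degree (a ^ i * b ^ j * c ^ k) \<le> i + j + k"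
    and "coeff (a ^ i * b ^ j * c ^ k) (i + j + k) = coeff a 1 ^ i * coeff b 1 ^ j * coeff c 1 ^ k"
proof -
  note * = assms[THEN degree_coeff_linear_power]
  have ab: "degree (a ^ i * b ^ j) \<le> i + j"
    using degree_mult_le[of "a ^ i" "b ^ j"] *(1)[of i] *(2)[of j] by simp
  then show "degree (a ^ i * b ^ j * c ^ k) \<le> i + j + k"
    using degree_mult_le[of "a ^ i * b ^ j" "c ^ k"] *(3)[of k] by simp
  show "coeff (a ^ i * b ^ j * c ^ k) (i + j + k) = coeff a 1 ^ i * coeff b 1 ^ j * coeff c 1 ^ k"
    using ab * by (simp add: coeff_mult_le)
qed

lemma degree_restrict3_le:
  assumes "homogeneous3 d F" "degree a \<le> 1" "degree b \<le> 1" "degree c \<le> 1"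
  shows "degree (restrict3 F a b c) \<le> d"
  unfolding restrict3_expand
proof (intro degree_sum_le finite_atMost)
  fix i j k
  show "degree (Polynomial.smult (coeff3 F i j k) (a ^ i * b ^ j * c ^ k)) \<le> d"
    using degree_coeff_linear_monomial(1)[OF assms(2-4), of i j k] assms(1)
    unfolding homogeneous3_def by (cases "coeff3 F i j k = 0") force+
qed

text \<open>Along the line \<open>v + s w\<close> the top coefficient is the value of the form at the direction \<open>w\<close>, the
  point at infinity of the line.\<close>

lemma coeff_restrict3_top:
  assumes "homogeneous3 d F" "degree a \<le> 1" "degree b \<le> 1" "degree c \<le> 1"
  shows "coeff (restrict3 F a b c) d = ev3 F (coeff a 1) (coeff b 1) (coeff c 1)"
  unfolding restrict3_expand ev3_expand coeff_sum
proof (intro sum.cong refl)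
  fix i j k
  show "coeff (Polynomial.smult (coeff3 F i j k) (a ^ i * b ^ j * c ^ k)) d =
      coeff3 F i j k * (coeff a 1 ^ i * coeff b 1 ^ j * coeff c 1 ^ k)"
    using degree_coeff_linear_monomial(2)[OF assms(2-4), of i j k] assms(1)
    unfolding homogeneous3_def by (cases "coeff3 F i j k = 0") force+
qed

section \<open>Order of vanishing along a line\<close>

abbreviation "dx \<equiv> map_poly (map_poly pderiv) :: poly3 \<Rightarrow> poly3"
abbreviation "dy \<equiv> map_poly pderiv :: poly3 \<Rightarrow> poly3"
abbreviation "dz \<equiv> pderiv :: poly3 \<Rightarrow> poly3"

lemma coeff_of_nat_mult': "coeff (of_nat n * p) k = of_nat n * coeff p k"
  for p :: "'a::comm_ring_1 poly"
  by (simp add: of_nat_poly)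

lemma pderiv_of_nat_mult: "pderiv (of_nat n * p) = of_nat n * pderiv p"
  for p :: "complex poly"
  by (simp add: of_nat_poly pderiv_smult)

lemma map_poly_pderiv_commute: "map_poly pderiv (pderiv q) = pderiv (map_poly pderiv q)"
  for q :: "complex poly poly"
  by (intro poly_eqI)
     (simp add: coeff_map_poly coeff_pderiv pderiv_of_nat_mult coeff_of_nat_mult' del: of_nat_Suc)

lemma dx_dy: "dx (dy F) = dy (dx F)"
  by (intro poly_eqI) (simp add: coeff_map_poly map_poly_pderiv_commute)

lemma dx_dz: "dx (dz F) = dz (dx F)"
  by (intro poly_eqI) (simp add: coeff_map_poly coeff_pderiv pderiv_of_nat_mult coeff_of_nat_mult' del: of_nat_Suc)

lemma dy_dz: "dy (dz F) = dz (dy F)"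
  by (intro poly_eqI) (simp add: coeff_map_poly coeff_pderiv pderiv_of_nat_mult coeff_of_nat_mult' del: of_nat_Suc)

lemma funpow_commute:
  assumes "\<And>x. f (g x) = g (f x)"
  shows "(f ^^ n) (g x) = g ((f ^^ n) x)"
  by (induction n) (simp_all add: assms)

lemma partial3_dx: "partial3 i j k (dx F) = partial3 (Suc i) j k F"
proof -
  have "partial3 i j k (dx F) = (dx ^^ i) ((dy ^^ j) (dx ((dz ^^ k) F)))"
    unfolding partial3_def by (simp only: funpow_commute[of dz dx, OF dx_dz[symmetric]])
  also have "\<dots> = (dx ^^ i) (dx ((dy ^^ j) ((dz ^^ k) F)))"
    by (simp only: funpow_commute[of dy dx, OF dx_dy[symmetric]])
  also have "\<dots> = partial3 (Suc i) j k F"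
    by (simp only: partial3_def funpow_Suc_right o_apply)
  finally show ?thesis .
qed

lemma partial3_dy: "partial3 i j k (dy F) = partial3 i (Suc j) k F"
proof -
  have "partial3 i j k (dy F) = (dx ^^ i) ((dy ^^ j) (dy ((dz ^^ k) F)))"
    unfolding partial3_def by (simp only: funpow_commute[of dz dy, OF dy_dz[symmetric]])
  also have "\<dots> = partial3 i (Suc j) k F"
    by (simp only: partial3_def funpow_Suc_right o_apply)
  finally show ?thesis .
qed

lemma partial3_dz: "partial3 i j k (dz F) = partial3 i j (Suc k) F"
  by (simp only: partial3_def funpow_Suc_right o_apply)

lemma pderiv_restrict3:
  "pderiv (restrict3 F a b c) = restrict3 (dx F) a b c * pderiv a +
     restrict3 (dy F) a b c * pderiv b + restrict3 (dz F) a b c * pderiv c"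
proof -
  define E where "E q = poly (map_poly (\<lambda>r. pcompose r a) q) b" for q
  have E0: "E 0 = 0" by (simp add: E_def)
  have E_pCons: "E (pCons r q) = pcompose r a + b * E q" for r q
    by (simp add: E_def Polynomial.map_poly_pCons)
  have E_add: "E (p + q) = E p + E q" for p q
    by (induction p q rule: poly_induct2) (simp_all add: E_pCons pcompose_add algebra_simps E0)
  have E_deriv: "pderiv (E q) = E (map_poly pderiv q) * pderiv a + E (pderiv q) * pderiv b" for q
    by (induction q)
       (simp_all add: E0 E_pCons E_add Polynomial.map_poly_pCons pderiv_pCons pderiv_add pderiv_mult
          pderiv_pcompose algebra_simps)
  define R where "R F = restrict3 F a b c" for F
  have R0: "R 0 = 0" by (simp add: R_def restrict3_def)
  have R_pCons: "R (pCons q F) = E q + c * R F" for q F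
    by (simp add: R_def restrict3_def E_def Polynomial.map_poly_pCons)
  have R_add: "R (F + G) = R F + R G" for F G
    by (induction F G rule: poly_induct2) (simp_all add: R_pCons E_add algebra_simps R0)
  have "pderiv (R F) = R (dx F) * pderiv a + R (dy F) * pderiv b + R (dz F) * pderiv c" 
    by (induction F)
       (simp_all add: R0 E0 R_pCons R_add Polynomial.map_poly_pCons pderiv_pCons pderiv_add pderiv_mult
          E_deriv algebra_simps)
  then show ?thesis by (simp add: R_def)
qed

text \<open>If all partial derivatives of order below \<open>m\<close> vanish at a point, then \<open>F\<close> vanishes to order \<open>m\<close>
  along every line through it: by the chain rule the derivative along the line combines restrictions of
  the first partial derivatives of \<open>F\<close>, which satisfy the hypothesis for \<open>m - 1\<close>.\<close>

lemma coeff_restrict3_eq_0: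
  assumes "\<And>i j k. i + j + k < m \<Longrightarrow> ev3 (partial3 i j k F) x y z = 0" and "n < m"
  shows "coeff (restrict3 F [:x, u:] [:y, v:] [:z, w:]) n = 0"
  using assms
proof (induction m arbitrary: F n)
  case (Suc m)
  let ?R = "\<lambda>F. restrict3 F [:x, u:] [:y, v:] [:z, w:]"
  show ?case
  proof (cases n)
    case 0
    have "ev3 F x y z = 0"
      using Suc.prems(1)[of 0 0 0] by (simp add: partial3_def)
    then show ?thesis
      using poly_restrict3[of F "[:x, u:]" "[:y, v:]" "[:z, w:]" 0] 0 by (simp add: poly_0_coeff_0)
  next
    case (Suc n')
    have "coeff (?R (dx F)) n' = 0" "coeff (?R (dy F)) n' = 0" "coeff (?R (dz F)) n' = 0"
      using Suc.prems Suc 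
      by (intro Suc.IH; simp add: partial3_dx partial3_dy partial3_dz)+
    then have "coeff (pderiv (?R F)) n' = 0"
      by (simp add: pderiv_restrict3 pderiv_pCons)
    then show ?thesis
      using Suc by (simp add: coeff_pderiv del: of_nat_Suc)
  qed
qed simp

section \<open>Weights and resultants\<close>

text \<open>Every term of the Leibniz expansion picks one entry from each row and each column. Row weights \<open>r\<close>
  and column weights \<open>c\<close> with \<open>r i - c j \<le> v i j\<close> thus bound the valuation of every term by the same
  number \<open>\<Sum> r - \<Sum> c\<close>.\<close>

lemma power_dvd_det:
  fixes A :: "'a::comm_ring_1 mat"
  assumes A: "A \<in> carrier_mat n n"
    and dvd: "\<And>i j. i < n \<Longrightarrow> j < n \<Longrightarrow> x ^ v i j dvd A $$ (i, j)"
    and le: "\<And>i j. i < n \<Longrightarrow> j < n \<Longrightarrow> r i \<le> v i j + c j"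
    and sum: "(\<Sum>i<n. r i) = e + (\<Sum>j<n. c j)"
  shows "x ^ e dvd det A"
  unfolding det_def'[OF A]
proof (intro dvd_sum dvd_mult)
  fix p assume "p \<in> {p. p permutes {0..<n}}"
  then have p: "p permutes {..<n}" by (simp add: atLeast0LessThan)
  have "(\<Sum>i<n. r i) \<le> (\<Sum>i<n. v i (p i) + c (p i))"
    using p by (intro sum_mono le) (auto simp: permutes_in_image[OF p, of _, simplified])
  also have "\<dots> = (\<Sum>i<n. v i (p i)) + (\<Sum>j<n. c j)"
    using sum.permute[OF p, of c] by (simp add: sum.distrib o_def)
  finally have "e \<le> (\<Sum>i<n. v i (p i))"
    using sum by simp
  then have "x ^ e dvd x ^ (\<Sum>i<n. v i (p i))"
    by (rule le_imp_power_dvd)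
  also have "\<dots> = (\<Prod>i<n. x ^ v i (p i))"
    by (rule power_sum)
  also have "\<dots> dvd (\<Prod>i<n. A $$ (i, p i))"
    using permutes_in_image[OF p] by (intro prod_dvd_prod dvd) auto
  finally show "x ^ e dvd (\<Prod>i = 0..<n. A $$ (i, p i))"
    by (simp add: atLeast0LessThan)
qed

text \<open>The same argument for degrees in place of valuations.\<close>

lemma degree_det_le:
  fixes A :: "'a::idom poly mat"
  assumes A: "A \<in> carrier_mat n n"
    and le: "\<And>i j. i < n \<Longrightarrow> j < n \<Longrightarrow> A $$ (i, j) \<noteq> 0 \<Longrightarrow> degree (A $$ (i, j)) + r i \<le> c j"
    and sum: "(\<Sum>j<n. c j) = e + (\<Sum>i<n. r i)"
  shows "degree (det A) \<le> e"
  unfolding det_def'[OF A]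
proof (rule degree_sum_le)
  show "finite {p. p permutes {0..<n}}" by (rule finite_permutations) simp
  fix p assume "p \<in> {p. p permutes {0..<n}}"
  then have p: "p permutes {..<n}" by (simp add: atLeast0LessThan)
  show "degree (signof p * (\<Prod>i = 0..<n. A $$ (i, p i))) \<le> e"
  proof (cases "\<forall>i<n. A $$ (i, p i) \<noteq> 0")
    case True
    have "degree (\<Prod>i<n. A $$ (i, p i)) + (\<Sum>i<n. r i) \<le> (\<Sum>i<n. degree (A $$ (i, p i)) + r i)"
      using degree_prod_sum_le[of "{..<n}" "\<lambda>i. A $$ (i, p i)"] by (simp add: sum.distrib o_def)
    also have "\<dots> \<le> (\<Sum>i<n. c (p i))"
      using True permutes_in_image[OF p] by (intro sum_mono le) auto
    also have "\<dots> = (\<Sum>j<n. c j)"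
      using sum.permute[OF p, of c] by (simp add: o_def)
    finally have "degree (\<Prod>i<n. A $$ (i, p i)) \<le> e"
      using sum by simp
    moreover have "degree (signof p * (\<Prod>i<n. A $$ (i, p i))) \<le> degree (\<Prod>i<n. A $$ (i, p i))"
      using degree_mult_le[of "signof p" "\<Prod>i<n. A $$ (i, p i)"] by (simp add: sign_def split: if_splits)
    ultimately show ?thesis by (simp add: atLeast0LessThan)
  next
    case False
    then have "(\<Prod>i = 0..<n. A $$ (i, p i)) = 0"
      by (intro prod_zero) auto
    then show ?thesis by (simp only: mult_zero_right degree_0)
  qed
qed

lemma poly_eq_sum_monom_rev:
  fixes p :: "'a::comm_ring_1 poly"
  assumes "degree p < n"
  shows "p = (\<Sum>l<n. Polynomial.smult (coeff p (n - Suc l)) (monom 1 (n - Suc l)))"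
proof -
  have "p = (\<Sum>l<n. Polynomial.smult (coeff p l) (monom 1 l))"
    using assms by (intro poly_eqI) (auto simp: coeff_sum coeff_eq_0 if_distrib cong: if_cong)
  also have "\<dots> = (\<Sum>l<n. Polynomial.smult (coeff p (n - Suc l)) (monom 1 (n - Suc l)))"
    by (rule sum.nat_diff_reindex[symmetric])
  finally show ?thesis .
qed

text \<open>The rows of the Sylvester matrix are the coefficient vectors of the multiples \<open>z\<^sup>k p\<close> and \<open>z\<^sup>k q\<close>,
  with the highest powers of \<open>z\<close> first.\<close>

definition sylvester_row :: "'a::comm_ring_1 poly \<Rightarrow> 'a poly \<Rightarrow> nat \<Rightarrow> 'a poly" where
  "sylvester_row p q i = (if i < degree q then monom 1 (degree q - Suc i) * p
     else monom 1 (degree p + degree q - Suc i) * q)"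

lemma sylvester_mat_index_row:
  fixes p q :: "'a::comm_ring_1 poly"
  assumes "i < degree p + degree q" "j < degree p + degree q"
  shows "sylvester_mat p q $$ (i, j) = coeff (sylvester_row p q i) (degree p + degree q - Suc j)"
proof -
  have shift: "coeff (monom 1 (Suc a) * r) (Suc b) = coeff (monom 1 a * r) b" for a b and r :: "'a poly"
    by (simp add: monom_Suc)
  have "degree p + degree q - j = Suc (degree p + degree q - Suc j)"
    using assms by simp
  moreover have "degree p + degree q - i = Suc (degree p + degree q - Suc i)"
    using assms by simp
  moreover have "degree q - i = Suc (degree q - Suc i)" if "i < degree q"
    using that by simp
  ultimately show ?thesis
    unfolding sylvester_index_mat2[OF assms] sylvester_row_def by (simp add: shift)
qed

lemma degree_sylvester_row:
  fixes p q :: "'a::idom poly"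
  assumes "i < degree p + degree q"
  shows "degree (sylvester_row p q i) < degree p + degree q"
proof (cases "i < degree q")
  case True
  have "degree (monom 1 (degree q - Suc i) * p) \<le> degree q - Suc i + degree p"
    using degree_mult_le[of "monom 1 (degree q - Suc i)" p] degree_monom_le[of "1::'a" "degree q - Suc i"]
    by linarith
  with True show ?thesis by (simp add: sylvester_row_def)
next
  case False
  have "degree (monom 1 (degree p + degree q - Suc i) * q) \<le> degree p + degree q - Suc i + degree q"
    using degree_mult_le[of "monom 1 (degree p + degree q - Suc i)" q]
      degree_monom_le[of "1::'a" "degree p + degree q - Suc i"]
    by linarith
  with False assms show ?thesis by (simp add: sylvester_row_def)
qed

lemma pcompose_monom_1: "pcompose (monom 1 n) q = q ^ n"
  for q :: "'a::comm_ring_1 poly"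
  by (induction n) (simp_all add: monom_Suc pcompose_pCons)

lemma index_mult_mat_sum:
  assumes "A \<in> carrier_mat n k" "B \<in> carrier_mat k m" "i < n" "j < m"
  shows "(A * B) $$ (i, j) = (\<Sum>l<k. A $$ (i, l) * B $$ (l, j))"
  using assms by (auto simp: scalar_prod_def atLeast0LessThan)

text \<open>Translating \<open>z\<close> changes the basis of monomials by a unipotent triangular matrix \<open>V\<close>. The rows
  \<open>(z + a)\<^sup>k p(z + a)\<close> obtained in this way are combinations of the rows \<open>z\<^sup>k p(z + a)\<close>, again with a
  unipotent triangular matrix \<open>U\<close>, and both determinants are 1.\<close>

lemma resultant_pcompose_shift:
  fixes p q :: "'a::idom poly"
  shows "resultant (pcompose p [:a, 1:]) (pcompose q [:a, 1:]) = resultant p q"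
proof -
  define X where "X = [:a, 1:]"
  have degX: "degree (X ^ e) = e" for e
    unfolding X_def by (rule degree_linear_power)
  have topX: "coeff (X ^ e) e = 1" for e
    unfolding X_def by (rule coeff_linear_power)
  define p' q' where "p' = pcompose p X" and "q' = pcompose q X"
  have deg: "degree p' = degree p" "degree q' = degree q"
    by (simp_all add: p'_def q'_def X_def)
  define m n N where "m = degree p" and "n = degree q" and "N = m + n"
  define V where "V = mat N N (\<lambda>(k, j). coeff (X ^ (N - Suc k)) (N - Suc j))"
  define U where "U = mat N N (\<lambda>(i, l).
    if i < n \<and> l < n then coeff (X ^ (n - Suc i)) (n - Suc l)
    else if n \<le> i \<and> n \<le> l then coeff (X ^ (N - Suc i)) (N - Suc l) else 0)"
  have carr: "V \<in> carrier_mat N N" "U \<in> carrier_mat N N"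
      "sylvester_mat p q \<in> carrier_mat N N" "sylvester_mat p' q' \<in> carrier_mat N N"
    using sylvester_carrier_mat[of p q] sylvester_carrier_mat[of p' q']
    by (simp_all add: V_def U_def N_def m_def n_def deg)
  have "sylvester_mat p q * V = U * sylvester_mat p' q'"
  proof (rule eq_matI)
    fix i j assume "i < dim_row (U * sylvester_mat p' q')" "j < dim_col (U * sylvester_mat p' q')"
    then have ij: "i < N" "j < N" using carr by auto
    let ?P = "sylvester_row p q"
    have "(sylvester_mat p q * V) $$ (i, j) =
        (\<Sum>k<N. coeff (?P i) (N - Suc k) * coeff (X ^ (N - Suc k)) (N - Suc j))"
      unfolding index_mult_mat_sum[OF carr(3,1) ij] using ij
      by (intro sum.cong refl) (simp add: V_def sylvester_mat_index_row N_def m_def n_def)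
    also have "\<dots> = coeff (pcompose (\<Sum>k<N. Polynomial.smult (coeff (?P i) (N - Suc k))
        (monom 1 (N - Suc k))) X) (N - Suc j)"
      by (simp add: pcompose_sum pcompose_smult pcompose_monom_1 coeff_sum)
    also have "\<dots> = coeff (pcompose (?P i) X) (N - Suc j)"
      using poly_eq_sum_monom_rev[of "?P i" N] degree_sylvester_row[of i p q] ij
      by (simp add: N_def m_def n_def)
    also have "\<dots> = (U * sylvester_mat p' q') $$ (i, j)"
    proof (cases "i < n")
      case True
      have "(U * sylvester_mat p' q') $$ (i, j) = (\<Sum>l<N. U $$ (i, l) * sylvester_mat p' q' $$ (l, j))"
        by (rule index_mult_mat_sum[OF carr(2,4) ij])
      also have "\<dots> = (\<Sum>l<n. U $$ (i, l) * sylvester_mat p' q' $$ (l, j))"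
        using True ij by (intro sum.mono_neutral_right) (auto simp: U_def N_def)
      also have "\<dots> = (\<Sum>l<n. coeff (X ^ (n - Suc i)) (n - Suc l) *
          coeff (monom 1 (n - Suc l) * p') (N - Suc j))"
        using True ij
        by (intro sum.cong refl)
           (simp add: U_def N_def m_def n_def sylvester_mat_index_row deg sylvester_row_def)
      also have "\<dots> = coeff ((\<Sum>l<n. Polynomial.smult (coeff (X ^ (n - Suc i)) (n - Suc l))
          (monom 1 (n - Suc l))) * p') (N - Suc j)"
        by (simp add: sum_distrib_right coeff_sum)
      also have "\<dots> = coeff (X ^ (n - Suc i) * p') (N - Suc j)"
        using poly_eq_sum_monom_rev[of "X ^ (n - Suc i)" n] True by (simp add: degX)
      finally show ?thesis
        using True by (simp add: sylvester_row_def n_def p'_def pcompose_mult pcompose_monom_1)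
    next
      case False
      have "(U * sylvester_mat p' q') $$ (i, j) = (\<Sum>l<N. U $$ (i, l) * sylvester_mat p' q' $$ (l, j))"
        by (rule index_mult_mat_sum[OF carr(2,4) ij])
      also have "\<dots> = (\<Sum>l<N. coeff (X ^ (N - Suc i)) (N - Suc l) *
          coeff (monom 1 (N - Suc l) * q') (N - Suc j))"
      proof (intro sum.cong refl)
        fix l assume "l \<in> {..<N}"
        then show "U $$ (i, l) * sylvester_mat p' q' $$ (l, j) =
          coeff (X ^ (N - Suc i)) (N - Suc l) * coeff (monom 1 (N - Suc l) * q') (N - Suc j)"
        proof (cases "l < n")
          case True
          then have "coeff (X ^ (N - Suc i)) (N - Suc l) = 0"
            using False ij by (intro coeff_eq_0) (simp add: degX)
          with True False ij \<open>l \<in> {..<N}\<close> show ?thesis by (simp add: U_def)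
        next
          case l: False
          then have "sylvester_mat p' q' $$ (l, j) = coeff (monom 1 (N - Suc l) * q') (N - Suc j)"
            using ij \<open>l \<in> {..<N}\<close>
            by (simp add: sylvester_mat_index_row deg sylvester_row_def N_def m_def n_def)
          with l False ij \<open>l \<in> {..<N}\<close> show ?thesis by (simp add: U_def)
        qed
      qed
      also have "\<dots> = coeff ((\<Sum>l<N. Polynomial.smult (coeff (X ^ (N - Suc i)) (N - Suc l))
          (monom 1 (N - Suc l))) * q') (N - Suc j)"
        by (simp add: sum_distrib_right coeff_sum)
      also have "\<dots> = coeff (X ^ (N - Suc i) * q') (N - Suc j)"
        using poly_eq_sum_monom_rev[of "X ^ (N - Suc i)" N] ij by (simp add: degX)
      finally show ?thesis
        using False by (simp add: sylvester_row_def n_def N_def m_def q'_def pcompose_mult pcompose_monom_1)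
    qed
    finally show "(sylvester_mat p q * V) $$ (i, j) = (U * sylvester_mat p' q') $$ (i, j)" .
  qed (use carr in auto)
  then have "det (sylvester_mat p q) * det V = det U * det (sylvester_mat p' q')"
    using carr by (metis det_mult)
  moreover have "det V = 1"
  proof -
    have "upper_triangular V"
      by (auto simp: V_def upper_triangular_def degX intro!: coeff_eq_0)
    then have "det V = prod_list (diag_mat V)"
      using carr(1) by (rule det_upper_triangular)
    also have "diag_mat V = map (\<lambda>i. 1) [0..<N]"
      by (auto simp: diag_mat_def V_def topX)
    finally show ?thesis by (simp add: map_replicate_const)
  qed
  moreover have "det U = 1"
  proof -
    have "upper_triangular U"
      by (auto simp: U_def upper_triangular_def degX intro!: coeff_eq_0)
    then have "det U = prod_list (diag_mat U)"
      using carr(2) by (rule det_upper_triangular)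
    also have "diag_mat U = map (\<lambda>i. 1) [0..<N]"
      by (auto simp: diag_mat_def U_def topX)
    finally show ?thesis by (simp add: map_replicate_const)
  qed
  ultimately show ?thesis
    by (simp add: resultant_def p'_def q'_def X_def)
qed

text \<open>The excess of the row weights over the column weights in \<open>power_dvd_resultant\<close>.\<close>

lemma sum_min_eq:
  fixes m n M N :: nat
  assumes "m \<le> M" "n \<le> N"
  shows "(\<Sum>i<N. m + min i n) + (\<Sum>j<M. n + min j m) = m * n + (\<Sum>k<M + N. min k (m + n))"
proof -
  have *: "2 * (\<Sum>k<a + e. min k a) + a = a * a + 2 * a * e" for a e :: nat
  proof (induction e)
    case 0
    have "2 * (\<Sum>k<a. k) + a = a * a"
      by (induction a) auto
    then show ?case by simp
  qed auto
  obtain e e' where "M = m + e" "N = n + e'"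
    using assms[THEN le_Suc_ex] by blast
  moreover from this have "M + N = (m + n) + (e + e')" by simp
  ultimately show ?thesis
    using *[of n e'] *[of m e] *[of "m + n" "e + e'"]
    by (simp add: sum.distrib algebra_simps)
qed

lemma sum_lessThan_add_split: "(\<Sum>i<N + M. f i) = (\<Sum>i<N. f i) + (\<Sum>i<M. f (N + i))"
  for f :: "nat \<Rightarrow> 'a::comm_monoid_add"
  by (induction M) (simp_all add: add.assoc)

text \<open>If \<open>p\<close> and \<open>q\<close> vanish to orders \<open>m\<close> and \<open>n\<close> at the origin, jointly in \<open>x\<close> and the variable of the
  polynomials, their intersection multiplicity there is at least \<open>m n\<close>. The entry of the row \<open>z\<^sup>i p\<close> at
  the monomial \<open>z\<^sup>k\<close> has valuation at least \<open>m + i - k\<close>, which suggests the weights \<open>m + i\<close> and \<open>k\<close>. The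
  cut-off at \<open>m + n\<close> reflects that valuations are never negative.\<close>

lemma power_dvd_resultant:
  fixes p q :: "'a::idom poly"
  assumes "m \<le> degree p" "n \<le> degree q"
    and p: "\<And>k. x ^ (m - k) dvd coeff p k" and q: "\<And>k. x ^ (n - k) dvd coeff q k"
  shows "x ^ (m * n) dvd resultant p q"
proof -
  define M N where "M = degree p" and "N = degree q"
  define r where "r i = (if i < N then m + min (N - Suc i) n else n + min (M + N - Suc i) m)" for i
  define c where "c j = min (M + N - Suc j) (m + n)" for j
  \<comment> \<open>At the entries outside the bands, which are zero, any exponent is admissible; \<open>m + n\<close> is
      large enough for the weight condition.\<close>
  define v where "v i j = (if i < N then (if i \<le> j \<and> j - i \<le> M then m - (M + i - j) else m + n)
    else if i - N \<le> j \<and> j \<le> i then n - (i - j) else m + n)" for i j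
  show ?thesis
    unfolding resultant_def
  proof (rule power_dvd_det[where v = v and r = r and c = c])
    show "sylvester_mat p q \<in> carrier_mat (M + N) (M + N)"
      using sylvester_carrier_mat by (simp add: M_def N_def)
    fix i j assume ij: "i < M + N" "j < M + N"
    have ij': "i < degree p + degree q" "j < degree p + degree q"
      using ij by (simp_all add: M_def N_def)
    have if_dvd: "x ^ (if b then k else l) dvd (if b then y else 0)" if "x ^ k dvd y" for b k l y
      using that by simp
    show "x ^ v i j dvd sylvester_mat p q $$ (i, j)"
      unfolding sylvester_index_mat[OF ij'] v_def M_def[symmetric] N_def[symmetric]
      by (cases "i < N") (simp_all only: if_True if_False if_dvd p q)
    show "r i \<le> v i j + c j"
    proof (cases "i < N")
      case True
      have "m + min R n \<le> (m - k) + min (R + k) (m + n)" for R k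
        by arith
      from this[of "N - Suc i" "M + i - j"] show ?thesis
        using True ij by (auto simp: r_def v_def c_def add.commute[of N M])
    next
      case False
      have "n + min R m \<le> (n - k) + min (R + k) (m + n)" for R k
        by arith
      from this[of "M + N - Suc i" "i - j"] show ?thesis
        using False ij
        by (auto simp: r_def v_def c_def add.commute[of N M] intro: order_trans[OF min.cobounded2 le_add1])
    qed
  next
    have "r (N + j) = n + min (M - Suc j) m" for j
      by (simp add: r_def)
    then have "(\<Sum>i<N + M. r i) = (\<Sum>i<N. m + min (N - Suc i) n) + (\<Sum>j<M. n + min (M - Suc j) m)"
      unfolding sum_lessThan_add_split by (simp add: r_def)
    then have "(\<Sum>i<M + N. r i) = (\<Sum>i<N. m + min (N - Suc i) n) + (\<Sum>j<M. n + min (M - Suc j) m)"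
      by (simp only: add.commute)
    also have "\<dots> = (\<Sum>i<N. m + min i n) + (\<Sum>j<M. n + min j m)"
      using sum.nat_diff_reindex[of "\<lambda>i. m + min i n" N] sum.nat_diff_reindex[of "\<lambda>i. n + min i m" M]
      by simp
    also have "\<dots> = m * n + (\<Sum>k<M + N. min k (m + n))"
      using assms(1,2) by (intro sum_min_eq) (simp_all add: M_def N_def)
    also have "(\<Sum>k<M + N. min k (m + n)) = (\<Sum>j<M + N. c j)"
      using sum.nat_diff_reindex[of "\<lambda>k. min k (m + n)" "M + N"] by (simp add: c_def)
    finally show "(\<Sum>i<M + N. r i) = m * n + (\<Sum>j<M + N. c j)" .
  qed
qed

text \<open>The upper half of the Bezout bound: with total degrees at most \<open>deg p\<close> and \<open>deg q\<close>, the entry of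
  a row \<open>z\<^sup>i p\<close> or \<open>z\<^sup>i q\<close> at \<open>z\<^sup>k\<close> has degree at most \<open>deg p + i - k\<close> or \<open>deg q + i - k\<close>.\<close>

lemma degree_resultant_le:
  fixes p q :: "'a::idom poly poly"
  assumes p: "\<And>k. coeff p k \<noteq> 0 \<Longrightarrow> degree (coeff p k) + k \<le> degree p"
    and q: "\<And>k. coeff q k \<noteq> 0 \<Longrightarrow> degree (coeff q k) + k \<le> degree q"
  shows "degree (resultant p q) \<le> degree p * degree q"
proof -
  define M N where "M = degree p" and "N = degree q"
  define r where "r i = (if i < N then i else i - N)" for i
  show ?thesis
    unfolding resultant_def M_def[symmetric] N_def[symmetric]
  proof (rule degree_det_le[where r = r and c = "\<lambda>j. j"])
    show "sylvester_mat p q \<in> carrier_mat (M + N) (M + N)"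
      using sylvester_carrier_mat by (simp add: M_def N_def)
    fix i j assume ij: "i < M + N" "j < M + N" and nz: "sylvester_mat p q $$ (i, j) \<noteq> 0"
    have ij': "i < degree p + degree q" "j < degree p + degree q"
      using ij by (simp_all add: M_def N_def)
    show "degree (sylvester_mat p q $$ (i, j)) + r i \<le> j"
      using nz p[of "M + i - j"] q[of "i - j"] ij
      unfolding sylvester_index_mat[OF ij'] r_def M_def[symmetric] N_def[symmetric]
      by (auto split: if_splits)
  next
    have *: "2 * (\<Sum>k<a. k) + a = a * a" for a :: nat
      by (induction a) auto
    have "(\<Sum>i<M + N. r i) = (\<Sum>i<N. i) + (\<Sum>i<M. i)"
      unfolding add.commute[of M] sum_lessThan_add_split by (simp add: r_def)
    then show "(\<Sum>j<M + N. j) = M * N + (\<Sum>i<M + N. r i)"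
      using *[of M] *[of N] *[of "M + N"] by (simp add: algebra_simps)
  qed
qed

section \<open>The discriminant of a curve in a chart\<close>

lemma poly_poly_at: "poly (poly f q) s = poly (poly f [:poly q s:]) s"
  for f :: "complex poly poly"
  by (induction f) simp_all

lemma poly2_ext:
  fixes p q :: "complex poly poly"
  assumes "\<And>x y. poly (poly p [:y:]) x = poly (poly q [:y:]) x"
  shows "p = q"
proof -
  have "[:p:] = [:q:]"
    by (rule ev3_ext) (simp add: ev3_def assms)
  then show ?thesis by simp
qed

lemma coeff_poly_line:
  fixes h :: "complex poly poly"
  shows "coeff (poly h [:0, b:]) n = (\<Sum>k\<le>n. coeff (coeff h k) (n - k) * b ^ k)"
proof (induction h arbitrary: n)
  case (pCons p h)
  show ?case
  proof (cases n)
    case (Suc n')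
    have "coeff (poly (pCons p h) [:0, b:]) n = coeff p n + b * coeff (poly h [:0, b:]) n'"
      using Suc by simp
    also have "\<dots> = (\<Sum>k\<le>n. coeff (coeff (pCons p h) k) (n - k) * b ^ k)"
      unfolding Suc sum.atMost_Suc_shift by (simp add: pCons.IH sum_distrib_left mult_ac)
    finally show ?thesis .
  qed simp
qed simp

text \<open>The homogeneous part of degree \<open>n\<close> of \<open>h(t, z)\<close> is zero once it is zero on all lines
  \<open>z = b t\<close>. This turns statements on restrictions to lines into statements on coefficients.\<close>

lemma coeff_eq_0_if_lines:
  fixes h :: "complex poly poly"
  assumes "\<And>b. coeff (poly h [:0, b:]) n = 0" and "k \<le> n"
  shows "coeff (coeff h k) (n - k) = 0"
proof -
  define P where "P = (\<Sum>k\<le>n. monom (coeff (coeff h k) (n - k)) k)"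
  have "poly P b = 0" for b
    using assms(1)[of b] by (simp add: P_def coeff_poly_line poly_sum poly_monom)
  then have "P = 0"
    using poly_all_0_iff_0 by blast
  moreover have "coeff P k = coeff (coeff h k) (n - k)"
    using assms(2) by (simp add: P_def coeff_sum if_distrib cong: if_cong)
  ultimately show ?thesis by simp
qed

lemma poly_map_poly_eval: "poly (map_poly (\<lambda>q. poly q t) f) z = poly (poly f [:z:]) t"
  for f :: "'a::comm_ring_1 poly poly"
  by (induction f) (simp_all add: Polynomial.map_poly_pCons)

lemma pderiv_map_poly_hom:
  assumes "comm_ring_hom h"
  shows "pderiv (map_poly h p) = map_poly h (pderiv p)"
proof -
  interpret comm_ring_hom h by fact
  show ?thesis
    by (intro poly_eqI) (simp add: coeff_map_poly coeff_pderiv hom_mult hom_of_nat del: of_nat_Suc)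
qed

lemma comm_ring_hom_map_poly_eval: "comm_ring_hom (map_poly (\<lambda>q. poly q t))"
  for t :: "'a::comm_ring_1"
proof -
  interpret comm_ring_hom "\<lambda>q. poly q t" by (rule poly_hom.comm_ring_hom_axioms)
  interpret map_poly_comm_ring_hom "\<lambda>q. poly q t" ..
  show ?thesis ..
qed

lemma resultant_pderiv_hom:
  fixes p :: "'a::{idom,ring_char_0} poly" and h :: "'a \<Rightarrow> 'b::{idom,ring_char_0}"
  assumes "comm_ring_hom h" "h (lead_coeff p) \<noteq> 0"
  shows "resultant (map_poly h p) (pderiv (map_poly h p)) = h (resultant p (pderiv p))"
proof -
  interpret comm_ring_hom h by fact
  have "degree (map_poly h p) = degree p"
    using assms(2) by (intro degree_map_poly) auto
  then show ?thesis
    by (subst resultant_map_poly[symmetric])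
       (simp_all add: pderiv_map_poly_hom[OF assms(1), symmetric] degree_pderiv)
qed

text \<open>A vanishing resultant gives a common factor of positive degree, which by irreducibility is \<open>p\<close>
  itself; but \<open>p\<close> cannot divide its derivative, which has smaller degree.\<close>

lemma resultant_pderiv_irreducible:
  fixes p :: "complex poly poly poly"
  assumes "irreducible p" "degree p > 0"
  shows "resultant p (pderiv p) \<noteq> 0"
proof
  assume "resultant p (pderiv p) = 0"
  then have deg: "degree (gcd p (pderiv p)) \<noteq> 0"
    by (simp add: resultant_0_gcd)
  then have "\<not> gcd p (pderiv p) dvd 1"
    by (auto simp: is_unit_poly_iff)
  moreover obtain w where w: "p = gcd p (pderiv p) * w"
    using gcd_dvd1 by (metis dvdE)
  ultimately have "w dvd 1"
    using assms(1) by (metis irreducibleD)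
  then have "p dvd gcd p (pderiv p)"
    using w by (metis dvd_mult_unit_iff dvd_refl)
  then have "p dvd pderiv p" by simp
  moreover have "pderiv p \<noteq> 0"
    using assms(2) by (simp add: pderiv_eq_0_iff)
  ultimately have "degree p \<le> degree (pderiv p)"
    by (rule dvd_imp_degree_le)
  then show False
    using assms(2) by (simp add: degree_pderiv)
qed

text \<open>The lines through \<open>P = (\<alpha> : \<beta> : 1)\<close> are parametrized by \<open>t\<close>, and \<open>z\<close> is a coordinate on each of them:
  the point with coordinates \<open>(t, z)\<close> is \<open>(c, 0, 0) + t (\<delta>, 1, 0) + z (\<alpha>, \<beta>, 1)\<close>. The line of \<open>P\<close>
  that is left out of the chart can be moved by \<open>\<delta>\<close>. For a general scale \<open>c\<close> the discriminant of the
  dehomogenized equation inherits from the form that it is not zero.\<close>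

locale curve_chart =
  fixes F :: poly3 and d :: nat and \<alpha> \<beta> \<delta> c :: complex and f :: "complex poly poly"
  assumes homogeneous: "homogeneous3 d F" and d_pos: "d > 0"
    and centre: "ev3 F \<alpha> \<beta> 1 \<noteq> 0" and c_nonzero: "c \<noteq> 0"
    and eval_f: "\<And>t z. poly (poly f [:z:]) t = ev3 F (c + \<delta> * t + \<alpha> * z) (t + \<beta> * z) z"
    and degree_f: "degree f = d" and coeff_f_top: "coeff f d = [:ev3 F \<alpha> \<beta> 1:]"
    and disc_nonzero: "resultant f (pderiv f) \<noteq> 0"
begin

definition disc :: "complex poly" where "disc = resultant f (pderiv f)"

text \<open>The total degree of \<open>f\<close> is at most \<open>d\<close> since \<open>F\<close> restricted to a line has degree at most \<open>d\<close>.\<close>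

lemma degree_coeff_f: 
  assumes "coeff f k \<noteq> 0"
  shows "degree (coeff f k) + k \<le> d"
proof (rule ccontr)
  assume "\<not> ?thesis"
  moreover define n where "n = degree (coeff f k) + k"
  ultimately have n: "n > d" by simp
  have "coeff (poly f [:0, b:]) n = 0" for b
  proof -
    have "poly f [:0, b:] = restrict3 F [:c, \<delta> + \<alpha> * b:] [:0, 1 + \<beta> * b:] [:0, b:]"
      by (rule poly_ext) (simp add: poly_poly_at[of f "[:0, b:]"] eval_f poly_restrict3 algebra_simps)
    moreover have "degree (restrict3 F [:c, \<delta> + \<alpha> * b:] [:0, 1 + \<beta> * b:] [:0, b:]) \<le> d"
      by (intro degree_restrict3_le homogeneous) simp_all
    ultimately show ?thesis
      using n by (simp add: coeff_eq_0)
  qed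
  from coeff_eq_0_if_lines[of f n, OF this, of k] have "lead_coeff (coeff f k) = 0"
    by (simp add: n_def)
  with assms show False by simp
qed

lemma degree_disc: "degree disc \<le> d * (d - 1)"
proof -
  have "degree (coeff (pderiv f) k) + k \<le> degree (pderiv f)" if "coeff (pderiv f) k \<noteq> 0" for k
  proof -
    from that have nz: "coeff f (Suc k) \<noteq> 0"
      by (auto simp: coeff_pderiv)
    have "degree (coeff (pderiv f) k) \<le> degree (coeff f (Suc k))"
      unfolding coeff_pderiv of_nat_poly by (simp del: of_nat_Suc)
    then show ?thesis
      using degree_coeff_f[OF nz] by (simp add: degree_pderiv degree_f)
  qed
  then have "degree disc \<le> degree f * degree (pderiv f)"
    unfolding disc_def using degree_coeff_f by (intro degree_resultant_le) (auto simp: degree_f)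
  then show ?thesis by (simp add: degree_pderiv degree_f)
qed

text \<open>Translate the point over \<open>t0\<close> to the origin, giving a polynomial \<open>h\<close>. Its homogeneous parts below
  degree \<open>m\<close> vanish because \<open>F\<close> vanishes to order \<open>m\<close> along all lines through the point, and those of
  the \<open>z\<close>-derivative of \<open>h\<close> vanish below degree \<open>m - 1\<close>. The resultant is then divisible by the power
  \<open>m (m - 1)\<close> of the translated parameter.\<close>

lemma order_disc:
  assumes vanish: "\<And>i j k. i + j + k < m \<Longrightarrow>
    ev3 (partial3 i j k F) (c + \<delta> * t0 + \<alpha> * z0) (t0 + \<beta> * z0) z0 = 0"
  shows "m * (m - 1) \<le> order t0 disc"
proof -
  define \<tau> where "\<tau> q = pcompose q [:t0, 1:]" for q :: "complex poly"
  have \<tau>: "comm_ring_hom \<tau>"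
    by unfold_locales (simp_all add: \<tau>_def pcompose_add pcompose_mult)
  have \<tau>_top: "\<tau> (lead_coeff f) = [:ev3 F \<alpha> \<beta> 1:]"
    by (simp add: \<tau>_def degree_f coeff_f_top)
  define g where "g = map_poly \<tau> f"
  have deg_g: "degree g = d"
    unfolding g_def degree_f[symmetric] using \<tau>_top centre
    by (intro degree_map_poly) (auto simp: \<tau>_def)
  define h where "h = pcompose g [:[:z0:], 1:]"
  have deg_h: "degree h = d"
    by (simp add: h_def deg_g)
  have top_h: "coeff h d = [:ev3 F \<alpha> \<beta> 1:]"
  proof -
    have "lead_coeff h = lead_coeff g"
      unfolding h_def by (subst lead_coeff_comp) simp_all
    also have "\<dots> = [:ev3 F \<alpha> \<beta> 1:]"
      unfolding deg_g using \<tau>_top by (simp add: g_def coeff_map_poly degree_f \<tau>_def)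
    finally show ?thesis by (simp add: deg_h)
  qed
  have eval_h: "poly (poly h [:z:]) t = poly (poly f [:z0 + z:]) (t0 + t)" for t z
  proof -
    have "poly (poly g [:y:]) t = poly (poly f [:y:]) (t0 + t)" for y
      unfolding g_def by (induction f) (simp_all add: Polynomial.map_poly_pCons \<tau>_def poly_pcompose)
    then show ?thesis by (simp add: h_def poly_pcompose)
  qed
  have low: "coeff (coeff h k) (n - k) = 0" if "k \<le> n" "n < m" for k n
  proof (rule coeff_eq_0_if_lines[OF _ that(1)])
    fix b
    have "poly h [:0, b:] = restrict3 F [:c + \<delta> * t0 + \<alpha> * z0, \<delta> + \<alpha> * b:]
        [:t0 + \<beta> * z0, 1 + \<beta> * b:] [:z0, b:]"
      by (rule poly_ext)
         (simp add: poly_poly_at[of h "[:0, b:]"] eval_h eval_f poly_restrict3 algebra_simps)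
    then show "coeff (poly h [:0, b:]) n = 0"
      using coeff_restrict3_eq_0[OF vanish that(2)] by simp
  qed
  \<comment> \<open>Otherwise all parts of \<open>h\<close> of degree at most \<open>d\<close> vanish, among them its leading coefficient.\<close>
  have "m \<le> d"
  proof (rule ccontr)
    assume "\<not> m \<le> d"
    then have "coeff (coeff h d) 0 = 0"
      using low[of d d] by simp
    then show False
      using top_h centre by simp
  qed
  have dvd_h: "[:0, 1:] ^ (m - k) dvd coeff h k" for k
  proof -
    have "monom 1 (m - k) dvd coeff h k"
      unfolding monom_1_dvd_iff'
    proof (intro allI impI)
      fix j assume "j < m - k"
      then show "coeff (coeff h k) j = 0"
        using low[of k "j + k"] by simp
    qed
    then show ?thesis by (simp add: monom_altdef)
  qed
  have "[:0, 1:] ^ (m * (m - 1)) dvd resultant h (pderiv h)"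
  proof (rule power_dvd_resultant)
    show "[:0, 1:] ^ (m - 1 - k) dvd coeff (pderiv h) k" for k
      using dvd_h[of "Suc k"] by (simp add: coeff_pderiv dvd_mult del: of_nat_Suc)
  qed (use \<open>m \<le> d\<close> dvd_h in \<open>simp_all add: deg_h degree_pderiv\<close>)
  also have "resultant h (pderiv h) = resultant g (pderiv g)"
    using resultant_pcompose_shift[of g "[:z0:]" "pderiv g"]
    by (simp add: h_def pderiv_pcompose pderiv_pCons)
  also have "\<dots> = pcompose disc [:t0, 1:]"
    unfolding g_def using \<tau>_top centre
    by (subst resultant_pderiv_hom[OF \<tau>]) (simp_all add: disc_def \<tau>_def)
  finally obtain w where w: "pcompose disc [:t0, 1:] = [:0, 1:] ^ (m * (m - 1)) * w"
    by (elim dvdE)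
  have "disc = pcompose (pcompose disc [:t0, 1:]) [:- t0, 1:]"
    by (rule poly_ext) (simp add: poly_pcompose)
  also have "\<dots> = [:- t0, 1:] ^ (m * (m - 1)) * pcompose w [:- t0, 1:]"
    unfolding w by (rule poly_ext) (simp add: poly_pcompose)
  finally show ?thesis
    using disc_nonzero by (metis disc_def dvd_triv_left order_divides)
qed

lemma card_roots_fibre:
  assumes "poly disc t \<noteq> 0"
  shows "card {z. ev3 F (c + \<delta> * t + \<alpha> * z) (t + \<beta> * z) z = 0} = d"
proof -
  define g where "g = map_poly (\<lambda>q. poly q t) f"
  have top: "poly (lead_coeff f) t \<noteq> 0"
    by (simp add: degree_f coeff_f_top centre)
  have deg: "degree g = d"
    unfolding g_def degree_f[symmetric] using top by (intro degree_map_poly) auto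
  then have "g \<noteq> 0" using d_pos by auto
  have "resultant g (pderiv g) \<noteq> 0"
    using resultant_pderiv_hom[OF poly_hom.comm_ring_hom_axioms top] assms by (simp add: g_def disc_def)
  then have gcd: "degree (gcd g (pderiv g)) = 0"
    by (simp add: resultant_0_gcd)
  have "rsquarefree g"
    unfolding rsquarefree_roots
  proof safe
    fix z assume "poly g z = 0" "poly (pderiv g) z = 0"
    then have "[:- z, 1:] dvd gcd g (pderiv g)"
      by (simp add: poly_eq_0_iff_dvd)
    then have "degree [:- z, 1:] \<le> degree (gcd g (pderiv g))"
      using \<open>g \<noteq> 0\<close> by (intro dvd_imp_degree_le) auto
    then show False using gcd by simp
  qed
  then have "g = Polynomial.smult (lead_coeff g) (\<Prod>z | poly g z = 0. [:- z, 1:])"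
    by (rule complex_poly_decompose_rsquarefree[symmetric])
  then have "degree g = degree (\<Prod>z | poly g z = 0. [:- z, 1:])"
    using \<open>g \<noteq> 0\<close> by (metis degree_smult_eq leading_coeff_0_iff)
  also have "\<dots> = card {z. poly g z = 0}"
    by (subst degree_prod_eq_sum_degree) auto
  finally show ?thesis
    using deg by (simp add: g_def poly_map_poly_eval eval_f)
qed

end

text \<open>The linear change of variables moves \<open>P\<close> to \<open>(0 : 0 : 1)\<close> and keeps \<open>F\<close> irreducible. The resultant
  \<open>R\<close> of the new form and its \<open>z\<close>-derivative is a non-zero polynomial in the first two variables, and it
  stays non-zero when the first variable is set to a general \<open>c\<close>.\<close>

lemma ex_curve_chart:
  assumes irr: "irreducible F" and hom: "homogeneous3 d F" and "d > 0"
    and centre: "ev3 F \<alpha> \<beta> 1 \<noteq> 0"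
  obtains c f where "curve_chart F d \<alpha> \<beta> \<delta> c f"
proof -
  define G where "G = subst3 (linform 1 \<delta> \<alpha>) (linform 0 1 \<beta>) (linform 0 0 1) F"
  have ev_G: "ev3 G x y z = ev3 F (x + \<delta> * y + \<alpha> * z) (y + \<beta> * z) z" for x y z
    by (simp add: G_def)
  have irr_G: "irreducible G"
    unfolding G_def
    by (rule irreducible_subst3[OF irr, where A' = "linform 1 (- \<delta>) (\<delta> * \<beta> - \<alpha>)"
          and B' = "linform 0 1 (- \<beta>)" and C' = "linform 0 0 1"];
        rule ev3_ext; simp add: algebra_simps)
  have coeff_G: "poly (poly (coeff G k) [:y:]) x =
      coeff (restrict3 F [:x + \<delta> * y, \<alpha>:] [:y, \<beta>:] [:0, 1:]) k" for x y k
  proof -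
    have "map_poly (\<lambda>q. poly (poly q [:y:]) x) G = restrict3 F [:x + \<delta> * y, \<alpha>:] [:y, \<beta>:] [:0, 1:]"
    proof (rule poly_ext)
      fix z
      have "poly (map_poly (\<lambda>q. poly (poly q [:y:]) x) G) z = ev3 G x y z"
        unfolding ev3_def by (induction G) (simp_all add: Polynomial.map_poly_pCons)
      then show "poly (map_poly (\<lambda>q. poly (poly q [:y:]) x) G) z =
          poly (restrict3 F [:x + \<delta> * y, \<alpha>:] [:y, \<beta>:] [:0, 1:]) z"
        by (simp add: ev_G poly_restrict3 mult.commute)
    qed
    then show ?thesis
      by (metis coeff_map_poly poly_0)
  qed
  have "coeff G k = 0" if "k > d" for k
  proof (rule poly2_ext)
    fix x y
    have "degree (restrict3 F [:x + \<delta> * y, \<alpha>:] [:y, \<beta>:] [:0, 1:]) \<le> d"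
      by (intro degree_restrict3_le hom) simp_all
    with that show "poly (poly (coeff G k) [:y:]) x = poly (poly 0 [:y:]) x"
      by (simp add: coeff_G coeff_eq_0)
  qed
  then have "degree G \<le> d"
    by (intro degree_le) simp
  moreover have top_G: "coeff G d = [:[:ev3 F \<alpha> \<beta> 1:]:]"
    by (rule poly2_ext) (simp add: coeff_G coeff_restrict3_top[OF hom])
  ultimately have deg_G: "degree G = d"
    using centre by (intro antisym le_degree) auto
  define R where "R = resultant G (pderiv G)"
  have "R \<noteq> 0"
    unfolding R_def using deg_G \<open>d > 0\<close> by (intro resultant_pderiv_irreducible irr_G) simp
  then have "finite (insert 0 {x. poly (lead_coeff R) x = 0})"
    by (simp add: poly_roots_finite)
  then obtain c where c: "c \<noteq> 0" "poly (lead_coeff R) c \<noteq> 0"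
    using ex_new_if_finite[OF infinite_UNIV_char_0] by blast
  define e where "e = map_poly (\<lambda>q. poly q c)"
  have e: "comm_ring_hom e" unfolding e_def by (rule comm_ring_hom_map_poly_eval)
  define f where "f = map_poly e G"
  have e_top: "e (lead_coeff G) = [:ev3 F \<alpha> \<beta> 1:]"
    by (simp add: deg_G top_G e_def Polynomial.map_poly_pCons)
  have "curve_chart F d \<alpha> \<beta> \<delta> c f"
  proof
    show "poly (poly f [:z:]) t = ev3 F (c + \<delta> * t + \<alpha> * z) (t + \<beta> * z) z" for t z
    proof -
      have "poly (poly f [:z:]) t = ev3 G c t z"
        unfolding f_def ev3_def
        by (induction G) (simp_all add: Polynomial.map_poly_pCons e_def poly_map_poly_eval)
      then show ?thesis by (simp add: ev_G)
    qed
    show "degree f = d"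
      unfolding f_def deg_G[symmetric] using e_top centre
      by (intro degree_map_poly) (auto simp: e_def)
    show "coeff f d = [:ev3 F \<alpha> \<beta> 1:]"
      using e_top by (simp add: f_def deg_G coeff_map_poly e_def)
    have "resultant f (pderiv f) = e R"
      unfolding f_def R_def using e_top centre by (intro resultant_pderiv_hom e) simp
    moreover have "coeff (e R) (degree R) \<noteq> 0"
      using c(2) by (simp add: e_def coeff_map_poly)
    ultimately show "resultant f (pderiv f) \<noteq> 0" by auto
  qed (use assms c in auto)
  then show thesis by (rule that)
qed

section \<open>Points of the projective line and plane\<close>

lemma vector2_simps:
  fixes x y :: complex
  shows "k *s (vector [x, y] :: complex ^ 2) = vector [k * x, k * y]"
    and "(vector [x, y] :: complex ^ 2) = vector [x', y'] \<longleftrightarrow> x = x' \<and> y = y'"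
    and "(vector [x, y] :: complex ^ 2) = 0 \<longleftrightarrow> x = 0 \<and> y = 0"
  by (simp_all add: Finite_Cartesian_Product.vec_eq_iff forall_2)

lemma vector3_simps:
  fixes x y z :: complex
  shows "k *s (vector [x, y, z] :: complex ^ 3) = vector [k * x, k * y, k * z]"
    and "(vector [x, y, z] :: complex ^ 3) = vector [x', y', z'] \<longleftrightarrow> x = x' \<and> y = y' \<and> z = z'"
    and "(vector [x, y, z] :: complex ^ 3) = 0 \<longleftrightarrow> x = 0 \<and> y = 0 \<and> z = 0"
  by (simp_all add: Finite_Cartesian_Product.vec_eq_iff forall_3)

lemma abs_cproj_eq_iff:
  assumes "v \<noteq> 0" "w \<noteq> 0"
  shows "abs_cproj v = abs_cproj w \<longleftrightarrow> (\<exists>k. w = k *s v)"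
proof -
  have "proj_eq u u" if "u \<noteq> 0" for u :: "complex ^ 'a"
    using that by (auto simp: proj_eq_def intro!: exI[of _ 1])
  then show ?thesis
    using Quotient3_rel[OF Quotient3_cproj, of v w] assms by (auto simp: proj_eq_def)
qed

lemma ex_abs_cproj: "\<exists>v. v \<noteq> 0 \<and> p = abs_cproj v"
  using Quotient3_abs_rep[OF Quotient3_cproj, of p] Quotient3_rep_reflp[OF Quotient3_cproj, of p]
  by (metis proj_eq_def)

definition pt2 :: "complex \<Rightarrow> complex \<Rightarrow> 2 cproj" where
  "pt2 x y = abs_cproj (vector [x, y])"

definition pt3 :: "complex \<Rightarrow> complex \<Rightarrow> complex \<Rightarrow> 3 cproj" where
  "pt3 x y z = abs_cproj (vector [x, y, z])"

lemma pt2_eq_iff: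
  assumes "(x, y) \<noteq> (0, 0)" "(x', y') \<noteq> (0, 0)"
  shows "pt2 x y = pt2 x' y' \<longleftrightarrow> (\<exists>k. k \<noteq> 0 \<and> x' = k * x \<and> y' = k * y)"
  using assms unfolding pt2_def
  by (subst abs_cproj_eq_iff) (auto simp: vector2_simps)

lemma pt3_eq_iff:
  assumes "(x, y, z) \<noteq> (0, 0, 0)" "(x', y', z') \<noteq> (0, 0, 0)"
  shows "pt3 x y z = pt3 x' y' z' \<longleftrightarrow> (\<exists>k. k \<noteq> 0 \<and> x' = k * x \<and> y' = k * y \<and> z' = k * z)"
  using assms unfolding pt3_def
  by (subst abs_cproj_eq_iff) (auto simp: vector3_simps)

lemma pt2_cases:
  obtains x y where "(x, y) \<noteq> (0, 0)" "q = pt2 x y"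
proof -
  obtain v where v: "v \<noteq> 0" "q = abs_cproj v"
    using ex_abs_cproj by blast
  moreover have "v = vector [vec_nth v 1, vec_nth v 2]"
    by (simp add: Finite_Cartesian_Product.vec_eq_iff forall_2)
  ultimately show thesis
    using that by (metis pt2_def vector2_simps(3) prod.inject)
qed

lemma pt3_cases:
  obtains x y z where "(x, y, z) \<noteq> (0, 0, 0)" "p = pt3 x y z"
proof -
  obtain v where v: "v \<noteq> 0" "p = abs_cproj v"
    using ex_abs_cproj by blast
  moreover have "v = vector [vec_nth v 1, vec_nth v 2, vec_nth v 3]"
    by (simp add: Finite_Cartesian_Product.vec_eq_iff forall_3)
  ultimately show thesis
    using that by (metis pt3_def vector3_simps(3) prod.inject)
qed

lemma hom_coords_pt3_iff:
  assumes "(x, y, z) \<noteq> (0, 0, 0)"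
  shows "hom_coords v (pt3 x y z) \<longleftrightarrow> (\<exists>k. k \<noteq> 0 \<and> v = vector [k * x, k * y, k * z])"
proof -
  have nz: "vector [x, y, z] \<noteq> (0 :: complex ^ 3)"
    using assms by (auto simp: vector3_simps)
  have "hom_coords v (pt3 x y z) \<longleftrightarrow> v \<noteq> 0 \<and> (\<exists>k. v = k *s vector [x, y, z])"
    using abs_cproj_eq_iff[OF nz, of v] by (auto simp: hom_coords_def pt3_def)
  then show ?thesis
    using assms by (auto simp: vector3_simps)
qed

lemma vanishes_at_pt3:
  assumes "homogeneous3 d F" "(x, y, z) \<noteq> (0, 0, 0)"
  shows "vanishes_at F (pt3 x y z) \<longleftrightarrow> ev3 F x y z = 0"
proof -
  have "vanishes_at F (pt3 x y z) \<longleftrightarrow> (\<forall>k. k \<noteq> 0 \<longrightarrow> ev3 F (k * x) (k * y) (k * z) = 0)"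
    unfolding vanishes_at_def hom_coords_pt3_iff[OF assms(2)] by (auto simp: eval3_vector)
  also have "\<dots> \<longleftrightarrow> ev3 F x y z = 0"
    unfolding ev3_homogeneous[OF assms(1)] by (metis mult_zero_right mult_eq_0_iff one_neq_zero power_one)
  finally show ?thesis .
qed

lemma maps_to_pt3:
  assumes A: "homogeneous3 e A" and B: "homogeneous3 e B" and nz: "(x, y, z) \<noteq> (0, 0, 0)"
  shows "maps_to A B (pt3 x y z) q \<longleftrightarrow>
    (ev3 A x y z, ev3 B x y z) \<noteq> (0, 0) \<and> q = pt2 (ev3 A x y z) (ev3 B x y z)"
proof -
  have "maps_to A B (pt3 x y z) q \<longleftrightarrow> (\<exists>k. k \<noteq> 0 \<and>
      (k ^ e * ev3 A x y z, k ^ e * ev3 B x y z) \<noteq> (0, 0) \<and>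
      q = pt2 (k ^ e * ev3 A x y z) (k ^ e * ev3 B x y z))"
    unfolding maps_to_def hom_coords_pt3_iff[OF nz] unfolding hom_coords_def pt2_def
    by (auto simp: eval3_vector ev3_homogeneous[OF A] ev3_homogeneous[OF B] vector2_simps)
  also have "\<dots> \<longleftrightarrow> (ev3 A x y z, ev3 B x y z) \<noteq> (0, 0) \<and> q = pt2 (ev3 A x y z) (ev3 B x y z)"
  proof -
    have *: "pt2 (k ^ e * a) (k ^ e * b) = pt2 a b" if "k \<noteq> 0" "(a, b) \<noteq> (0, 0)" for k a b
    proof -
      have "pt2 a b = pt2 (k ^ e * a) (k ^ e * b)"
        using that by (subst pt2_eq_iff) (auto intro!: exI[of _ "k ^ e"])
      then show ?thesis by simp
    qed
    show ?thesis (is "(\<exists>k. ?P k) \<longleftrightarrow> ?Q")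
    proof
      assume "\<exists>k. ?P k"
      then obtain k where k: "?P k" ..
      then have "(ev3 A x y z, ev3 B x y z) \<noteq> (0, 0)" by auto
      with k * show ?Q by simp
    next
      assume ?Q
      then have "?P 1" by simp
      then show "\<exists>k. ?P k" ..
    qed
  qed
  finally show ?thesis .
qed

lemma pt3_eq_if_minors_eq_0:
  assumes nz: "(x, y, z) \<noteq> (0, 0, 0)" "(x', y', z') \<noteq> (0, 0, 0)"
    and m: "x * y' = x' * y" "x * z' = x' * z" "y * z' = y' * z"
  shows "pt3 x y z = pt3 x' y' z'"
proof -
  have *: "\<exists>k. x' = k * x \<and> y' = k * y \<and> z' = k * z"
  proof -
    consider "x \<noteq> 0" | "y \<noteq> 0" | "z \<noteq> 0" using nz by auto
    then show ?thesis
    proof cases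
      case 1
      then show ?thesis using m by (intro exI[of _ "x' / x"]) (auto simp: field_simps)
    next
      case 2
      then show ?thesis using m by (intro exI[of _ "y' / y"]) (auto simp: field_simps)
    next
      case 3
      then show ?thesis using m by (intro exI[of _ "z' / z"]) (auto simp: field_simps)
    qed
  qed
  then show ?thesis
    unfolding pt3_eq_iff[OF nz] using nz(2) by auto
qed

section \<open>The projection from the centre and the gonality\<close>

context curve_chart
begin

text \<open>The two linear forms that vanish at \<open>P\<close> and take the values \<open>c\<close> and \<open>t\<close> on the line over \<open>t\<close>.\<close>

abbreviation "proj_x \<equiv> linform 1 (- \<delta>) (\<delta> * \<beta> - \<alpha>)"
abbreviation "proj_y \<equiv> linform 0 1 (- \<beta>)"
abbreviation "line_point t z \<equiv> pt3 (c + \<delta> * t + \<alpha> * z) (t + \<beta> * z) z"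

lemma line_point_nonzero: "(c + \<delta> * t + \<alpha> * z, t + \<beta> * z, z) \<noteq> (0, 0, 0)"
  using c_nonzero by auto

lemma map_fibre_proj:
  "map_fibre (plane_curve F) proj_x proj_y (pt2 c t) =
     line_point t ` {z. ev3 F (c + \<delta> * t + \<alpha> * z) (t + \<beta> * z) z = 0}"
proof safe
  note hom = homogeneous3_linform[of 1 "- \<delta>" "\<delta> * \<beta> - \<alpha>"] homogeneous3_linform[of 0 1 "- \<beta>"]
  fix z assume "ev3 F (c + \<delta> * t + \<alpha> * z) (t + \<beta> * z) z = 0"
  moreover have "ev3 proj_x (c + \<delta> * t + \<alpha> * z) (t + \<beta> * z) z = c"
      "ev3 proj_y (c + \<delta> * t + \<alpha> * z) (t + \<beta> * z) z = t"
    by (simp_all add: algebra_simps)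
  ultimately show "line_point t z \<in> map_fibre (plane_curve F) proj_x proj_y (pt2 c t)"
    unfolding map_fibre_def plane_curve_def mem_Collect_eq
      vanishes_at_pt3[OF homogeneous line_point_nonzero] maps_to_pt3[OF hom line_point_nonzero]
    using c_nonzero by (simp only:) simp
next
  note hom = homogeneous3_linform[of 1 "- \<delta>" "\<delta> * \<beta> - \<alpha>"] homogeneous3_linform[of 0 1 "- \<beta>"]
  fix p assume p: "p \<in> map_fibre (plane_curve F) proj_x proj_y (pt2 c t)"
  obtain x y z where nz: "(x, y, z) \<noteq> (0, 0, 0)" and p_eq: "p = pt3 x y z"
    by (rule pt3_cases)
  let ?a = "ev3 proj_x x y z" and ?b = "ev3 proj_y x y z"
  have F0: "ev3 F x y z = 0" and ab: "(?a, ?b) \<noteq> (0, 0)" and eq: "pt2 c t = pt2 ?a ?b"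
    using p unfolding p_eq map_fibre_def plane_curve_def
    by (auto simp only: mem_Collect_eq vanishes_at_pt3[OF homogeneous nz] maps_to_pt3[OF hom nz])
  have "(c, t) \<noteq> (0, 0)" using c_nonzero by simp
  then obtain k where k: "k \<noteq> 0" "c = k * ?a" "t = k * ?b"
    using pt2_eq_iff[OF ab, of c t] eq by metis
  have coords: "k * x = c + \<delta> * t + \<alpha> * (k * z)" "k * y = t + \<beta> * (k * z)"
    by (subst k(2), subst k(3), simp add: algebra_simps) (subst k(3), simp add: algebra_simps)
  have "p = pt3 (k * x) (k * y) (k * z)"
    unfolding p_eq using nz k(1) by (subst pt3_eq_iff) auto
  moreover have "ev3 F (k * x) (k * y) (k * z) = 0"
    by (simp add: ev3_homogeneous[OF homogeneous] F0)
  ultimately show "p \<in> line_point t ` {z. ev3 F (c + \<delta> * t + \<alpha> * z) (t + \<beta> * z) z = 0}"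
    using coords by auto
qed

lemma inj_line_point: "inj (line_point t)"
proof (rule injI)
  fix z z' assume "line_point t z = line_point t z'"
  then obtain k where k: "c + \<delta> * t + \<alpha> * z' = k * (c + \<delta> * t + \<alpha> * z)"
      "t + \<beta> * z' = k * (t + \<beta> * z)" "z' = k * z"
    unfolding pt3_eq_iff[OF line_point_nonzero line_point_nonzero] by auto
  then have "t = k * t" and "c + \<delta> * t = k * c + \<delta> * (k * t)"
    by (simp_all add: algebra_simps)
  then have "c = k * c" by (metis add_right_cancel)
  then have "k = 1" using c_nonzero by simp
  with k(3) show "z = z'" by simp
qed

lemma card_map_fibre_proj:
  assumes "poly disc t \<noteq> 0"
  shows "card (map_fibre (plane_curve F) proj_x proj_y (pt2 c t)) = d"
  unfolding map_fibre_proj using card_roots_fibre[OF assms]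
  by (subst card_image) (auto intro: inj_on_subset[OF inj_line_point])

text \<open>The exceptional fibres lie over zeros of the discriminant or over the one point \<open>(0 : 1)\<close> outside
  the chart. As the projective line is infinite, \<open>d\<close> is the only number of
  points that all but finitely many fibres can share.\<close>

lemma gonality_le_degree: "gonality (plane_curve F) \<le> d"
proof -
  let ?card = "\<lambda>q. card (map_fibre (plane_curve F) proj_x proj_y q)"
  have "inj (pt2 c)"
    using c_nonzero by (auto intro!: injI simp: pt2_eq_iff)
  then have inf: "infinite (UNIV :: 2 cproj set)"
    using finite_imageD[of "pt2 c" UNIV] infinite_UNIV_char_0 finite_subset[OF subset_UNIV] by blast
  have "disc \<noteq> 0"
    using disc_nonzero by (simp add: disc_def)
  have fin: "finite {q. ?card q \<noteq> d}"
  proof (rule finite_subset)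
    show "{q. ?card q \<noteq> d} \<subseteq> insert (pt2 0 1) (pt2 c ` {t. poly disc t = 0})"
    proof
      fix q assume q: "q \<in> {q. ?card q \<noteq> d}"
      obtain x y where xy: "(x, y) \<noteq> (0, 0)" "q = pt2 x y"
        by (rule pt2_cases)
      show "q \<in> insert (pt2 0 1) (pt2 c ` {t. poly disc t = 0})"
      proof (cases "x = 0")
        case True
        then have "pt2 0 1 = q"
          using xy by (simp add: pt2_eq_iff)
        then show ?thesis by simp
      next
        case False
        then have "q = pt2 c (c * y / x)"
          unfolding xy(2) using c_nonzero
          by (subst pt2_eq_iff) (auto intro!: exI[of _ "c / x"])
        then show ?thesis
          using q card_map_fibre_proj[of "c * y / x"] by auto
      qed
    qed
    show "finite (insert (pt2 0 1) (pt2 c ` {t. poly disc t = 0}))"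
      using \<open>disc \<noteq> 0\<close> by (simp add: poly_roots_finite)
  qed
  have "map_degree (plane_curve F) proj_x proj_y = d"
    unfolding map_degree_def
  proof (rule the_equality[of "\<lambda>n. finite {q. ?card q \<noteq> n}", OF fin])
    fix n assume "finite {q. ?card q \<noteq> n}"
    with fin have "finite ({q. ?card q \<noteq> n} \<union> {q. ?card q \<noteq> d})" by simp
    moreover have "{q. ?card q \<noteq> n} \<union> {q. ?card q \<noteq> d} = UNIV" if "n \<noteq> d"
      using that by auto
    ultimately show "n = d" using inf by metis
  qed
  moreover have "nonconstant_map (plane_curve F) proj_x proj_y"
    unfolding nonconstant_map_def
  proof
    show "\<exists>e. homogeneous3 e proj_x \<and> homogeneous3 e proj_y"
      using homogeneous3_linform by blast
    have "infinite {q. ?card q = d}"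
    proof
      assume "finite {q. ?card q = d}"
      with fin have "finite ({q. ?card q = d} \<union> {q. ?card q \<noteq> d})" by simp
      also have "{q. ?card q = d} \<union> {q. ?card q \<noteq> d} = UNIV" by auto
      finally show False using inf by simp
    qed
    then obtain q where q: "?card q = d"
      using infinite_imp_nonempty by blast
    from \<open>infinite {q. ?card q = d}\<close> have "infinite ({q. ?card q = d} - {q})" by simp
    then obtain q' where q': "?card q' = d" "q' \<noteq> q"
      using infinite_imp_nonempty by blast
    have "map_fibre (plane_curve F) proj_x proj_y r \<noteq> {}" if "?card r = d" for r
      using that d_pos by auto
    then show "\<exists>q q'. q \<noteq> q' \<and> map_fibre (plane_curve F) proj_x proj_y q \<noteq> {} \<and>
        map_fibre (plane_curve F) proj_x proj_y q' \<noteq> {}"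
      using q q' by metis
  qed
  ultimately show ?thesis
    unfolding gonality_def by (intro Least_le) blast
qed

end

section \<open>A general centre and the inequality\<close>

text \<open>The point \<open>P\<close> has to avoid the curve and the finitely many lines that join two of the given points.
  It also has to avoid the line \<open>z = 0\<close>, so that its third coordinate can be scaled to 1. All these
  conditions hold at a point where the product of the corresponding forms does not vanish. The
  inequality on \<open>\<alpha>\<close> and \<open>\<beta>\<close> says that the points \<open>i\<close> and \<open>j\<close> are not collinear with \<open>P\<close>.\<close>

lemma ex_generic_centre:
  fixes X Y Z :: "'i \<Rightarrow> complex"
  assumes hom: "homogeneous3 d F" and "F \<noteq> 0" and "finite I"
    and nz: "\<And>i. i \<in> I \<Longrightarrow> (X i, Y i, Z i) \<noteq> (0, 0, 0)"
    and inj: "inj_on (\<lambda>i. pt3 (X i) (Y i) (Z i)) I"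
  obtains \<alpha> \<beta> where "ev3 F \<alpha> \<beta> 1 \<noteq> 0"
    and "\<And>i j. i \<in> I \<Longrightarrow> j \<in> I \<Longrightarrow> i \<noteq> j \<Longrightarrow>
      (X i - \<alpha> * Z i) * (Y j - \<beta> * Z j) \<noteq> (X j - \<alpha> * Z j) * (Y i - \<beta> * Z i)"
proof -
  define l where "l = (\<lambda>(i, j). linform (Y i * Z j - Y j * Z i) (X j * Z i - X i * Z j) (X i * Y j - X j * Y i))"
  define IJ where "IJ = {(i, j) \<in> I \<times> I. i \<noteq> j}"
  have fin: "finite IJ"
    using \<open>finite I\<close> by (auto simp: IJ_def intro: finite_subset[of _ "I \<times> I"])
  have "l ij \<noteq> 0" if "ij \<in> IJ" for ij
  proof -
    from that obtain i j where ij: "ij = (i, j)" "i \<in> I" "j \<in> I" "i \<noteq> j"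
      by (auto simp: IJ_def)
    show "l ij \<noteq> 0"
    proof
      assume "l ij = 0"
      then have "X i * Y j = X j * Y i" "X i * Z j = X j * Z i" "Y i * Z j = Y j * Z i"
        by (simp_all add: l_def ij(1) linform_eq_0_iff)
      then have "pt3 (X i) (Y i) (Z i) = pt3 (X j) (Y j) (Z j)"
        by (rule pt3_eq_if_minors_eq_0[OF nz[OF ij(2)] nz[OF ij(3)]])
      then show False
        using inj_onD[OF inj _ ij(2,3)] ij(4) by simp
    qed
  qed
  then have "F * linform 0 0 1 * prod l IJ \<noteq> 0"
    using \<open>F \<noteq> 0\<close> fin by (simp add: linform_eq_0_iff)
  then obtain x y z where "ev3 (F * linform 0 0 1 * prod l IJ) x y z \<noteq> ev3 0 x y z"
    using ev3_ext by blast
  then have z: "z \<noteq> 0" and Fnz: "ev3 F x y z \<noteq> 0"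
    and lnz: "\<And>i j. i \<in> I \<Longrightarrow> j \<in> I \<Longrightarrow> i \<noteq> j \<Longrightarrow> ev3 (l (i, j)) x y z \<noteq> 0"
    using fin by (auto simp: ev3_prod IJ_def)
  show thesis
  proof (rule that[of "x / z" "y / z"])
    show "ev3 F (x / z) (y / z) 1 \<noteq> 0"
      using ev3_homogeneous[OF hom, of "1 / z" x y z] Fnz z by simp
    fix i j assume "i \<in> I" "j \<in> I" "i \<noteq> j"
    then have "ev3 (l (i, j)) x y z \<noteq> 0" by (rule lnz)
    moreover have "ev3 (l (i, j)) x y z = z * ((X i - x / z * Z i) * (Y j - y / z * Z j) -
        (X j - x / z * Z j) * (Y i - y / z * Z i))"
      using z by (simp add: l_def field_simps)
    ultimately show "(X i - x / z * Z i) * (Y j - y / z * Z j) \<noteq>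
        (X j - x / z * Z j) * (Y i - y / z * Z i)"
      by auto
  qed
qed

theorem lemma2p6:
  fixes F :: poly3 and d s :: nat and p :: "nat \<Rightarrow> 3 cproj" and m :: "nat \<Rightarrow> nat"
  assumes "irreducible F" and "homogeneous3 d F" and "d \<ge> 3"
    and "s \<ge> 3" and "bij_betw p {1..s} (singular_locus F)"
    and "\<And>i. i \<in> {1..s} \<Longrightarrow> m i = curve_mult F (p i)"
    and "\<And>i. i \<in> {1..s} \<Longrightarrow> m i \<ge> 2"
    and "\<And>i j. 1 \<le> i \<Longrightarrow> i \<le> j \<Longrightarrow> j \<le> s \<Longrightarrow> m j \<le> m i"
  shows "d\<^sup>2 \<ge> (\<Sum>i=1..s. m i * (m i - 1)) + gonality (plane_curve F)"
proof -
  have "\<forall>i. \<exists>x y z. (x, y, z) \<noteq> (0, 0, 0) \<and> p i = pt3 x y z"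
    using pt3_cases by metis
  then obtain X Y Z where nz: "\<And>i. (X i, Y i, Z i) \<noteq> (0, 0, 0)" and p_eq: "\<And>i. p i = pt3 (X i) (Y i) (Z i)"
    by metis
  have "F \<noteq> 0"
    using assms(1) by (simp add: irreducible_def)
  have inj: "inj_on (\<lambda>i. pt3 (X i) (Y i) (Z i)) {1..s}"
    using assms(5) by (simp add: bij_betw_def flip: p_eq)
  obtain \<alpha> \<beta> where centre: "ev3 F \<alpha> \<beta> 1 \<noteq> 0"
    and sep: "\<And>i j. i \<in> {1..s} \<Longrightarrow> j \<in> {1..s} \<Longrightarrow> i \<noteq> j \<Longrightarrow>
      (X i - \<alpha> * Z i) * (Y j - \<beta> * Z j) \<noteq> (X j - \<alpha> * Z j) * (Y i - \<beta> * Z i)"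
    by (rule ex_generic_centre[where X = X and Y = Y and Z = Z,
          OF assms(2) \<open>F \<noteq> 0\<close> finite_atLeastAtMost nz inj]) blast
  \<comment> \<open>The line through \<open>P\<close> outside the chart must miss every \<open>p i\<close>, which excludes at most one
    value of \<open>\<delta>\<close> for each \<open>i\<close>.\<close>
  have "finite ((\<lambda>i. (X i - \<alpha> * Z i) / (Y i - \<beta> * Z i)) ` {1..s})" by simp
  then obtain \<delta> where \<delta>: "\<delta> \<notin> (\<lambda>i. (X i - \<alpha> * Z i) / (Y i - \<beta> * Z i)) ` {1..s}"
    using ex_new_if_finite[OF infinite_UNIV_char_0] by blast
  define u where "u i = X i - \<alpha> * Z i - \<delta> * (Y i - \<beta> * Z i)" for i
  have u: "u i \<noteq> 0" if i: "i \<in> {1..s}" for i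
  proof (cases "Y i - \<beta> * Z i = 0")
    case True
    obtain j where "j \<in> {1..s}" "j \<noteq> i"
      using assms(4) i by (intro that[of "if i = 1 then 2 else 1"]) auto
    then show ?thesis
      using sep[OF i, of j] True by (auto simp: u_def)
  next
    case False
    have "\<delta> \<noteq> (X i - \<alpha> * Z i) / (Y i - \<beta> * Z i)"
      using \<delta> i by blast
    then show ?thesis
      using False by (auto simp: u_def field_simps)
  qed
  have "d > 0" using assms(3) by simp
  obtain c f where "curve_chart F d \<alpha> \<beta> \<delta> c f"
    by (rule ex_curve_chart[OF assms(1,2) \<open>d > 0\<close> centre])
  then interpret curve_chart F d \<alpha> \<beta> \<delta> c f .
  \<comment> \<open>The point \<open>p i\<close> has first coordinate \<open>u i\<close> in the coordinates centred at \<open>P\<close>; scaling it by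
    \<open>r i\<close> puts it into the chart, over the parameter \<open>t i\<close>.\<close>
  define r where "r i = c / u i" for i
  define t where "t i = r i * (Y i - \<beta> * Z i)" for i
  have order: "m i * (m i - 1) \<le> order (t i) disc" if i: "i \<in> {1..s}" for i
  proof (rule order_disc)
    fix a b e assume "a + b + e < m i"
    then have "vanishes_at (partial3 a b e F) (p i)"
      unfolding assms(6)[OF i] curve_mult_def by (auto dest: not_less_Least)
    moreover have "hom_coords (vector [r i * X i, r i * Y i, r i * Z i]) (p i)"
      unfolding p_eq hom_coords_pt3_iff[OF nz] using u[OF i] c_nonzero by (intro exI[of _ "r i"]) (simp add: r_def)
    ultimately have "ev3 (partial3 a b e F) (r i * X i) (r i * Y i) (r i * Z i) = 0"
      by (auto simp: vanishes_at_def simp flip: eval3_vector)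
    moreover have "r i * X i = c + \<delta> * t i + \<alpha> * (r i * Z i)"
    proof -
      have "c = r i * u i" using u[OF i] by (simp add: r_def)
      then show ?thesis by (simp add: t_def u_def algebra_simps)
    qed
    moreover have "r i * Y i = t i + \<beta> * (r i * Z i)"
      by (simp add: t_def algebra_simps)
    ultimately show "ev3 (partial3 a b e F) (c + \<delta> * t i + \<alpha> * (r i * Z i))
        (t i + \<beta> * (r i * Z i)) (r i * Z i) = 0"
      by simp
  qed
  have "inj_on t {1..s}"
  proof (rule inj_onI, rule ccontr)
    fix i j assume ij: "i \<in> {1..s}" "j \<in> {1..s}" "t i = t j" "i \<noteq> j"
    then have "c * ((Y i - \<beta> * Z i) * u j) = c * ((Y j - \<beta> * Z j) * u i)"
      using u[OF ij(1)] u[OF ij(2)] by (simp add: t_def r_def field_simps)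
    then have "(Y i - \<beta> * Z i) * u j = (Y j - \<beta> * Z j) * u i"
      using c_nonzero by simp
    then show False
      using sep[OF ij(1,2,4)] by (simp add: u_def algebra_simps)
  qed
  have "disc \<noteq> 0" using disc_nonzero by (simp add: disc_def)
  have "(\<Sum>i=1..s. m i * (m i - 1)) \<le> (\<Sum>i=1..s. order (t i) disc)"
    using order by (rule sum_mono)
  also have "\<dots> = (\<Sum>x\<in>t ` {1..s}. order x disc)"
    using sum.reindex[OF \<open>inj_on t {1..s}\<close>, of "\<lambda>x. order x disc"] by (simp add: o_def)
  also have "\<dots> \<le> (\<Sum>x | poly disc x = 0. order x disc)"
  proof (rule sum_mono2)
    show "finite {x. poly disc x = 0}"
      using \<open>disc \<noteq> 0\<close> by (rule poly_roots_finite)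
    show "t ` {1..s} \<subseteq> {x. poly disc x = 0}"
    proof safe
      fix i assume i: "i \<in> {1..s}"
      have "order (t i) disc \<noteq> 0"
        using order[OF i] assms(7)[OF i] mult_pos_pos[of "m i" "m i - 1"] by linarith
      then show "poly disc (t i) = 0"
        by (simp add: order_root)
    qed
  qed simp
  also have "\<dots> \<le> degree disc"
    using \<open>disc \<noteq> 0\<close> by (rule sum_order_le_degree)
  also have "\<dots> \<le> d * (d - 1)"
    by (rule degree_disc)
  finally have "(\<Sum>i=1..s. m i * (m i - 1)) + gonality (plane_curve F) \<le> d * (d - 1) + d"
    using gonality_le_degree by (rule add_mono)
  also have "\<dots> = d\<^sup>2"
    using assms(3) by (cases d) (simp_all add: power2_eq_square)
  finally show ?thesis .
qed

end
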